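(* Let $\alpha \in (0,1)$, let $\mathcal{G}$ be a compact connected metric graph with a nonempty set $\mathcal{V}_D$ of Dirichlet vertices, and define $\tilde{\mathcal{G}}$ by replacing each edge of $\mathcal{G}$ with two parallel copies of equal length (with the same vertices and the same Dirichlet vertices). Then $$T_{\alpha}(\mathcal{G})\leq \frac{1}{2}\, T_{\alpha}(\tilde{\mathcal{G}}).$$
   Context: A compact metric graph $\mathcal{G}$ is obtained from a finite graph with vertex set $\mathcal{V}$ and edge set $\mathcal{E}$ (loops and parallel edges allowed) by identifying each edge $e$ with an interval $[0,\ell_e]$, $0<\ell_e<\infty$, and gluing endpoints according to the graph structure. A nonempty set $\mathcal{V}_D\subseteq\mathcal{V}$ of Dirichlet vertices is fixed. $L^2(\mathcal{G})=\bigoplus_{e}L^2(0,\ell_e)$ with inner product $\langle\cdot,\cdot\rangle$. The Laplacian $-\Delta_{\mathcal{G}}$ acts as $-f_e''$ on each edge, with domain the edgewise $H^2$ functions that are continuous at every vertex, vanish at every $v\in\mathcal{V}_D$, and at every $v\in\mathcal{V}\setminus\mathcal{V}_D$ satisfy the Kirchhoff condition: the sum, over all edge ends incident to $v$, of the derivatives at $v$ taken in the direction pointing into $v$, is zero. It is self-adjoint with compact resolvent, with eigenvalues $0<\lambda_1\le\lambda_2\le\cdots\to\infty$ (with multiplicity) and an $L^2$-orthonormal basis of eigenfunctions $\varphi_n$. For $\alpha\in(0,1)$, $(-\Delta_{\mathcal{G}})^\alpha f=\sum_n\lambda_n^\alpha\langle f,\varphi_n\rangle\varphi_n$ on the domain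 $\{f\in L^2(\mathcal{G}):\sum_n\lambda_n^{2\alpha}|\langle f,\varphi_n\rangle|^2<\infty\}$. The fractional torsion function $u_\alpha$ is the unique solution of $(-\Delta_{\mathcal{G}})^\alpha u_\alpha=1$, i.e. $u_\alpha=\sum_n\lambda_n^{-\alpha}\langle 1,\varphi_n\rangle\varphi_n$, and the fractional torsional rigidity is $T_\alpha(\mathcal{G})=\int_{\mathcal{G}}u_\alpha\,dx=\sum_n\lambda_n^{-\alpha}|\langle1,\varphi_n\rangle|^2$. Doubling an edge means replacing it by two parallel edges, each of the same length as the original edge, between the same pair of vertices. *)

theory Defs
  imports "HOL-Analysis.Analysis"
begin

section \<open>Compact metric graphs with Dirichlet vertices\<close>

text \<open>
  The vertices and the edges are all the elements of two finite types, so every finite graph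
  with at least one edge is covered; loops and parallel edges are allowed.
  An edge \<open>e\<close> is the interval from \<open>0\<close> (glued to \<open>tail G e\<close>) to \<open>len G e\<close> (glued to
  \<open>head G e\<close>); the orientation is only a parametrisation.
  Positivity of the lengths is not built into the type.
\<close>

record ('v, 'e) metric_graph =
  tail :: "'e \<Rightarrow> 'v"
  head :: "'e \<Rightarrow> 'v"
  len :: "'e \<Rightarrow> real"
  dirichlet :: "'v set"

text \<open>
  As edges are intervals, the metric graph is connected iff any two vertices are joined by a
  walk, edges being traversable in both directions.
\<close>

definition graph_connected :: "('v, 'e) metric_graph \<Rightarrow> bool" where
  "graph_connected G \<longleftrightarrow>
     (\<forall>v w. (v, w) \<in> (range (\<lambda>e. (tail G e, head G e)) \<union> range (\<lambda>e. (head G e, tail G e)))\<^sup>*)"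

definition double_edges :: "('v, 'e) metric_graph \<Rightarrow> ('v, 'e \<times> bool) metric_graph" where
  "double_edges G =
     \<lparr> tail = (\<lambda>(e, b). tail G e), head = (\<lambda>(e, b). head G e),
       len = (\<lambda>(e, b). len G e), dirichlet = dirichlet G \<rparr>"


section \<open>The space \<open>L\<^sup>2\<close>\<close>

text \<open>
  A (real-valued) function on the graph is represented by \<open>f e x\<close> with \<open>x\<close> in
  \<open>{0..len G e}\<close>; values outside this interval are irrelevant. Elements of \<open>L\<^sup>2\<close> are given by
  representatives, and equality in \<open>L\<^sup>2\<close> is equality almost everywhere on each edge.
\<close>

type_synonym 'e graph_fun = "'e \<Rightarrow> real \<Rightarrow> real"

abbreviation edge_measure :: "('v, 'e) metric_graph \<Rightarrow> 'e \<Rightarrow> real measure" where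
  "edge_measure G e \<equiv> lebesgue_on {0..len G e}"

definition L2 :: "('v, 'e) metric_graph \<Rightarrow> 'e graph_fun set" where
  "L2 G = {f. \<forall>e. f e \<in> borel_measurable (edge_measure G e) \<and>
                  integrable (edge_measure G e) (\<lambda>x. (f e x)\<^sup>2)}"

definition graph_integral :: "('v, 'e::finite) metric_graph \<Rightarrow> 'e graph_fun \<Rightarrow> real" where
  "graph_integral G f = (\<Sum>e\<in>UNIV. \<integral>x. f e x \<partial>edge_measure G e)"

definition L2_inner :: "('v, 'e::finite) metric_graph \<Rightarrow> 'e graph_fun \<Rightarrow> 'e graph_fun \<Rightarrow> real" where
  "L2_inner G f g = graph_integral G (\<lambda>e x. f e x * g e x)"

definition L2_norm :: "('v, 'e::finite) metric_graph \<Rightarrow> 'e graph_fun \<Rightarrow> real" where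
  "L2_norm G f = sqrt (L2_inner G f f)"

definition L2_sums :: "('v, 'e::finite) metric_graph \<Rightarrow> (nat \<Rightarrow> 'e graph_fun) \<Rightarrow> 'e graph_fun \<Rightarrow> bool" where
  "L2_sums G h f \<longleftrightarrow>
     (\<lambda>N. L2_norm G (\<lambda>e x. f e x - (\<Sum>n<N. h n e x))) \<longlonglongrightarrow> 0"


section \<open>The Laplacian\<close>

text \<open>
  \<open>f\<close> is the \<open>C\<^sup>1\<close> representative of an element of \<open>H\<^sup>2(0,l)\<close>: its derivative \<open>f'\<close> (one-sided
  at the end points) is absolutely continuous with weak derivative \<open>f''\<close> in \<open>L\<^sup>2\<close>.
\<close>

definition H2_derivs :: "real \<Rightarrow> (real \<Rightarrow> real) \<Rightarrow> (real \<Rightarrow> real) \<Rightarrow> (real \<Rightarrow> real) \<Rightarrow> bool" where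
  "H2_derivs l f f' f'' \<longleftrightarrow>
     (\<forall>x\<in>{0..l}. (f has_real_derivative f' x) (at x within {0..l})) \<and>
     f'' \<in> borel_measurable (lebesgue_on {0..l}) \<and>
     integrable (lebesgue_on {0..l}) (\<lambda>x. (f'' x)\<^sup>2) \<and>
     (\<forall>x\<in>{0..l}. f' x = f' 0 + (\<integral>t. f'' t \<partial>lebesgue_on {0..x}))"

definition continuous_at_vertices :: "('v, 'e) metric_graph \<Rightarrow> 'e graph_fun \<Rightarrow> bool" where
  "continuous_at_vertices G f \<longleftrightarrow>
     (\<exists>h. (\<forall>e. f e 0 = h (tail G e) \<and> f e (len G e) = h (head G e)) \<and>
          (\<forall>v\<in>dirichlet G. h v = 0))"

text \<open>
  The derivative into the vertex is \<open>f' e (len G e)\<close> at the head of \<open>e\<close> and \<open>- f' e 0\<close> at its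
  tail; a loop contributes both of its ends.
\<close>

definition kirchhoff :: "('v, 'e::finite) metric_graph \<Rightarrow> 'e graph_fun \<Rightarrow> bool" where
  "kirchhoff G f' \<longleftrightarrow>
     (\<forall>v. v \<notin> dirichlet G \<longrightarrow>
        (\<Sum>e | head G e = v. f' e (len G e)) + (\<Sum>e | tail G e = v. - f' e 0) = 0)"

text \<open>
  The graph of the operator: \<open>f\<close> lies in the domain and \<open>g\<close> is minus its Laplacian. It is a
  relation because the second derivative is only determined almost everywhere.
\<close>

definition neg_laplacian :: "('v, 'e::finite) metric_graph \<Rightarrow> 'e graph_fun \<Rightarrow> 'e graph_fun \<Rightarrow> bool" where
  "neg_laplacian G f g \<longleftrightarrow>
     (\<exists>f' f''. (\<forall>e. H2_derivs (len G e) (f e) (f' e) (f'' e)) \<and>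
        continuous_at_vertices G f \<and> kirchhoff G f' \<and>
        (\<forall>e. AE x in edge_measure G e. g e x = - f'' e x))"


section \<open>Spectral decomposition and fractional powers\<close>

text \<open>Indices start at \<open>0\<close>, so \<open>lam n\<close> is the \<open>(n+1)\<close>-st eigenvalue counted with multiplicity.\<close>

definition eigenbasis ::
    "('v, 'e::finite) metric_graph \<Rightarrow> (nat \<Rightarrow> real) \<Rightarrow> (nat \<Rightarrow> 'e graph_fun) \<Rightarrow> bool" where
  "eigenbasis G lam phi \<longleftrightarrow>
     (\<forall>n. 0 < lam n) \<and> incseq lam \<and> filterlim lam at_top sequentially \<and>
     (\<forall>n. neg_laplacian G (phi n) (\<lambda>e x. lam n * phi n e x)) \<and>
     (\<forall>m n. L2_inner G (phi m) (phi n) = (if m = n then 1 else 0)) \<and>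
     (\<forall>f\<in>L2 G. L2_sums G (\<lambda>n e x. L2_inner G f (phi n) * phi n e x) f)"

text \<open>
  One eigenbasis is fixed. The eigenvalues and the operators defined from it do not depend on
  the choice.
\<close>

definition spectral_data :: "('v, 'e::finite) metric_graph \<Rightarrow> (nat \<Rightarrow> real) \<times> (nat \<Rightarrow> 'e graph_fun)" where
  "spectral_data G = (SOME (lam, phi). eigenbasis G lam phi)"

definition eigval :: "('v, 'e::finite) metric_graph \<Rightarrow> nat \<Rightarrow> real" where
  "eigval G = fst (spectral_data G)"

definition eigfun :: "('v, 'e::finite) metric_graph \<Rightarrow> nat \<Rightarrow> 'e graph_fun" where
  "eigfun G = snd (spectral_data G)"

text \<open>
  The graph of the fractional Laplacian of order \<open>\<alpha>\<close>: \<open>f\<close> lies in its domain and is mapped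
  to \<open>g\<close>, which is determined up to equality almost everywhere.
\<close>

definition frac_laplacian ::
    "('v, 'e::finite) metric_graph \<Rightarrow> real \<Rightarrow> 'e graph_fun \<Rightarrow> 'e graph_fun \<Rightarrow> bool" where
  "frac_laplacian G \<alpha> f g \<longleftrightarrow>
     f \<in> L2 G \<and>
     summable (\<lambda>n. eigval G n powr (2 * \<alpha>) * (L2_inner G f (eigfun G n))\<^sup>2) \<and>
     g \<in> L2 G \<and>
     L2_sums G (\<lambda>n e x. eigval G n powr \<alpha> * L2_inner G f (eigfun G n) * eigfun G n e x) g"

text \<open>The torsion function is unique up to equality almost everywhere; a representative is chosen.\<close>

definition torsion_function :: "('v, 'e::finite) metric_graph \<Rightarrow> real \<Rightarrow> 'e graph_fun" where
  "torsion_function G \<alpha> = (SOME u. frac_laplacian G \<alpha> u (\<lambda>e x. 1))"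

definition torsional_rigidity :: "('v, 'e::finite) metric_graph \<Rightarrow> real \<Rightarrow> real" where
  "torsional_rigidity G \<alpha> = graph_integral G (torsion_function G \<alpha>)"

end

theory Submission
  imports Defs "HOL-Library.Function_Algebras" "HOL-Complex_Analysis.Great_Picard"
begin

text \<open>
  A torsion function \<open>u\<close> of \<open>G\<close>, copied to both members of each pair of parallel edges, is a
  torsion function of the doubled graph, so the inequality is in fact an equality. Indeed,
  let \<open>\<phi>\<close> be an eigenfunction of the doubled graph with eigenvalue \<open>\<mu>\<close>. Adding its values on
  parallel edges gives a function \<open>\<psi>\<close> on \<open>G\<close> with \<open>-\<Delta>\<psi> = \<mu>\<psi>\<close> (possibly \<open>\<psi> = 0\<close>), and pairing
  a copied function with \<open>\<phi>\<close> is the same as pairing the original function with \<open>\<psi>\<close>. Hence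
  \<open>\<mu>\<^sup>\<alpha> \<langle>u, \<psi>\<rangle> = \<langle>1, \<psi>\<rangle>\<close> is the equation that characterises the torsion function on the
  doubled graph.

  Since the spectral data are chosen by \<open>SOME\<close>, an eigenbasis has to be shown to exist. It comes
  from the spectral theorem for the Green operator, which is computed explicitly up to a linear
  system for the vertex values and is compact by Arzela-Ascoli.
\<close>

section \<open>The spectral theorem for compact positive operators\<close>

text \<open>Functions are representatives, so \<open>L2_inner\<close> is only semidefinite. Instead
  of passing to a quotient, vectors count as equal when their difference is null. This leaves a gap
  at one point: the spectral theorem yields eigenvectors up to null functions only, whereas
  \<open>neg_laplacian\<close> asks for a representative with derivatives and vertex values.
  Applying the Green operator once more to each eigenvector supplies it.

  The bases chosen for the two graphs are unrelated, and an eigenfunction of the doubled graph need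
  not agree on parallel edges, so eigenbases are never matched with each other. Only the coefficient
  equations of the torsion function cross over, and for this they are tested against arbitrary
  eigenfunctions of \<open>G\<close>. In the comparison the lifted function is handled as a square
  integrable function only; derivatives and vertex conditions are checked for folded
  eigenfunctions.\<close>

locale semi_inner_space =
  fixes S :: "'a::real_vector set" and B :: "'a \<Rightarrow> 'a \<Rightarrow> real"
  assumes subspace_S: "subspace S"
    and commute: "\<lbrakk>x \<in> S; y \<in> S\<rbrakk> \<Longrightarrow> B x y = B y x"
    and add_left: "\<lbrakk>x \<in> S; y \<in> S; z \<in> S\<rbrakk> \<Longrightarrow> B (x + y) z = B x z + B y z"
    and scale_left: "\<lbrakk>x \<in> S; y \<in> S\<rbrakk> \<Longrightarrow> B (c *\<^sub>R x) y = c * B x y"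
    and nonneg: "x \<in> S \<Longrightarrow> 0 \<le> B x x"
begin

lemma mem [simp, intro]:
  "0 \<in> S" "\<lbrakk>x \<in> S; y \<in> S\<rbrakk> \<Longrightarrow> x + y \<in> S" "\<lbrakk>x \<in> S; y \<in> S\<rbrakk> \<Longrightarrow> x - y \<in> S"
  "x \<in> S \<Longrightarrow> c *\<^sub>R x \<in> S" "(\<And>i. i \<in> A \<Longrightarrow> f i \<in> S) \<Longrightarrow> sum f A \<in> S"
  using subspace_S by (auto simp: subspace_0 subspace_add subspace_diff subspace_scale subspace_sum)

lemma add_right: "\<lbrakk>x \<in> S; y \<in> S; z \<in> S\<rbrakk> \<Longrightarrow> B z (x + y) = B z x + B z y"
  using add_left[of x y z] by (simp add: commute)

lemma scale_right: "\<lbrakk>x \<in> S; y \<in> S\<rbrakk> \<Longrightarrow> B y (c *\<^sub>R x) = c * B y x"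
  using scale_left[of x y c] by (simp add: commute)

lemma diff_left: "\<lbrakk>x \<in> S; y \<in> S; z \<in> S\<rbrakk> \<Longrightarrow> B (x - y) z = B x z - B y z"
  using add_left[of "x - y" y z] by simp

lemma diff_right: "\<lbrakk>x \<in> S; y \<in> S; z \<in> S\<rbrakk> \<Longrightarrow> B z (x - y) = B z x - B z y"
  using diff_left[of x y z] by (simp add: commute)

lemma zero_left: "x \<in> S \<Longrightarrow> B 0 x = 0"
  using scale_left[of x x 0] by simp

lemma sum_left:
  assumes "finite A" "\<And>i. i \<in> A \<Longrightarrow> f i \<in> S" "x \<in> S"
  shows "B (sum f A) x = (\<Sum>i\<in>A. B (f i) x)"
  using assms by (induction A rule: finite_induct) (auto simp: zero_left add_left)

lemma sum_right:
  assumes "finite A" "\<And>i. i \<in> A \<Longrightarrow> f i \<in> S" "x \<in> S"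
  shows "B x (sum f A) = (\<Sum>i\<in>A. B x (f i))"
  using sum_left[OF assms] assms by (simp add: commute)

lemmas bilin = add_left add_right diff_left diff_right scale_left scale_right

lemma cauchy_schwarz:
  assumes "x \<in> S" "y \<in> S"
  shows "(B x y)\<^sup>2 \<le> B x x * B y y"
proof -
  have q: "0 \<le> B x x + 2 * t * B x y + t\<^sup>2 * B y y" for t
  proof -
    have "0 \<le> B (x + t *\<^sub>R y) (x + t *\<^sub>R y)"
      using assms by (intro nonneg) auto
    also have "\<dots> = B x x + 2 * t * B x y + t\<^sup>2 * B y y"
      using assms by (simp add: bilin commute[of y x] power2_eq_square algebra_simps)
    finally show ?thesis .
  qed
  show ?thesis
  proof (cases "B y y = 0")
    case True
    have "B x y = 0"
    proof (rule ccontr)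
      assume ne: "B x y \<noteq> 0"
      \<comment> \<open>With \<open>B y y = 0\<close> the quadratic is affine in \<open>t\<close>,
        and at this \<open>t\<close> its value is \<open>-1\<close>.\<close>
      show False
        using q[of "- (B x x + 1) / (2 * B x y)"] ne True by (simp add: field_simps)
    qed
    then show ?thesis using True by simp
  next
    case False
    then have pos: "0 < B y y" using nonneg[of y] assms by simp
    have "0 \<le> B x x - (B x y)\<^sup>2 / B y y"
      using q[of "- B x y / B y y"] pos by (simp add: field_simps power2_eq_square)
    then show ?thesis using pos by (simp add: field_simps)
  qed
qed

lemma diff_sq_commute: "\<lbrakk>x \<in> S; y \<in> S\<rbrakk> \<Longrightarrow> B (x - y) (x - y) = B (y - x) (y - x)"
  by (simp add: bilin)

lemma scale_sq: "x \<in> S \<Longrightarrow> B (c *\<^sub>R x) (c *\<^sub>R x) = c\<^sup>2 * B x x"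
  by (simp add: bilin power2_eq_square)

lemma null_left: "\<lbrakk>x \<in> S; y \<in> S; B x x = 0\<rbrakk> \<Longrightarrow> B x y = 0"
  using cauchy_schwarz[of x y] by simp

text \<open>The parallelogram law for \<open>x - y\<close> and \<open>y - z\<close>, with one square
  dropped. It serves as triangle inequality for squared distances; the factor 2 is harmless in
  limits.\<close>

lemma quasi_triangle:
  assumes "x \<in> S" "y \<in> S" "z \<in> S"
  shows "B (x - z) (x - z) \<le> 2 * B (x - y) (x - y) + 2 * B (y - z) (y - z)"
proof -
  have "0 \<le> B ((x - y) - (y - z)) ((x - y) - (y - z))"
    using assms by (intro nonneg) auto
  also have "\<dots> = 2 * B (x - y) (x - y) + 2 * B (y - z) (y - z) - B (x - z) (x - z)"
    using assms by (simp add: bilin commute)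
  finally show ?thesis by simp
qed

text \<open>Stated with squared distances, so that no square root enters the abstract theory. A
  limit is determined up to a null vector.\<close>

definition converges :: "(nat \<Rightarrow> 'a) \<Rightarrow> 'a \<Rightarrow> bool" where
  "converges X x \<longleftrightarrow> (\<lambda>n. B (X n - x) (X n - x)) \<longlonglongrightarrow> 0"

definition is_cauchy :: "(nat \<Rightarrow> 'a) \<Rightarrow> bool" where
  "is_cauchy X \<longleftrightarrow> (\<forall>\<epsilon>>0. \<exists>N. \<forall>m\<ge>N. \<forall>n\<ge>N. B (X m - X n) (X m - X n) < \<epsilon>)"

lemma converges_inner:
  assumes "converges X x" "\<And>n. X n \<in> S" "x \<in> S" "y \<in> S"
  shows "(\<lambda>n. B (X n) y) \<longlonglongrightarrow> B x y"
proof -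
  have "(\<lambda>n. (B (X n) y - B x y)\<^sup>2) \<longlonglongrightarrow> 0"
  proof (rule tendsto_sandwich[OF _ _ tendsto_const])
    show "\<forall>\<^sub>F n in sequentially. (B (X n) y - B x y)\<^sup>2 \<le> B (X n - x) (X n - x) * B y y"
      using cauchy_schwarz[of "X n - x" y for n] assms by (simp add: diff_left)
    show "(\<lambda>n. B (X n - x) (X n - x) * B y y) \<longlonglongrightarrow> 0"
      using assms(1) tendsto_mult_left_zero unfolding converges_def by blast
  qed auto
  then have "(\<lambda>n. B (X n) y - B x y) \<longlonglongrightarrow> 0"
    using tendsto_power_zero power_tendsto_0_iff[of 2] by auto
  then show ?thesis by (simp add: LIM_zero_cancel)
qed

text \<open>Both limits have the same pairing with \<open>x - y\<close>, because the pairing with a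
  fixed vector is continuous.\<close>

lemma converges_unique:
  assumes "converges X x" "converges X y" "\<And>n. X n \<in> S" "x \<in> S" "y \<in> S"
  shows "B (x - y) (x - y) = 0"
proof -
  have "(\<lambda>n. B (X n) (x - y) - B (X n) (x - y)) \<longlonglongrightarrow> B x (x - y) - B y (x - y)"
    using assms by (intro tendsto_diff converges_inner) auto
  then show ?thesis
    using assms LIMSEQ_unique[OF _ tendsto_const[of 0]] by (fastforce simp: diff_left)
qed

lemma converges_add_null:
  assumes "converges X x" "(\<lambda>n. B (X n - Y n) (X n - Y n)) \<longlonglongrightarrow> 0"
    "\<And>n. X n \<in> S" "\<And>n. Y n \<in> S" "x \<in> S"
  shows "converges Y x"
  unfolding converges_def
proof (rule tendsto_sandwich[OF _ _ tendsto_const])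
  show "\<forall>\<^sub>F n in sequentially. B (Y n - x) (Y n - x)
      \<le> 2 * B (X n - Y n) (X n - Y n) + 2 * B (X n - x) (X n - x)"
    using quasi_triangle[of "Y n" "X n" x for n] assms
    by (simp add: bilin algebra_simps commute)
  show "(\<lambda>n. 2 * B (X n - Y n) (X n - Y n) + 2 * B (X n - x) (X n - x)) \<longlonglongrightarrow> 0"
    using tendsto_add[OF tendsto_mult_right_zero[OF assms(2), of 2]
        tendsto_mult_right_zero[OF assms(1)[unfolded converges_def], of 2]] by simp
  show "\<forall>\<^sub>F n in sequentially. 0 \<le> B (Y n - x) (Y n - x)"
    using assms by (simp add: nonneg)
qed

lemma converges_equiv:
  assumes "converges X g" "B (g - f) (g - f) = 0" "\<And>n. X n \<in> S" "g \<in> S" "f \<in> S"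
  shows "converges X f"
  unfolding converges_def
proof (rule tendsto_sandwich[OF _ _ tendsto_const])
  show "\<forall>\<^sub>F n in sequentially. B (X n - f) (X n - f) \<le> 2 * B (X n - g) (X n - g)"
    using quasi_triangle[of "X n" g f for n] assms by simp
  show "(\<lambda>n. 2 * B (X n - g) (X n - g)) \<longlonglongrightarrow> 0"
    using assms(1) tendsto_mult_right_zero unfolding converges_def by blast
qed (use assms in \<open>auto intro!: nonneg always_eventually\<close>)

section \<open>Orthonormal systems, Bessel's inequality and orthogonal expansions\<close>

definition orthonormal :: "'i set \<Rightarrow> ('i \<Rightarrow> 'a) \<Rightarrow> bool" where
  "orthonormal A \<phi> \<longleftrightarrow> (\<forall>i\<in>A. \<phi> i \<in> S) \<and> (\<forall>i\<in>A. \<forall>j\<in>A. B (\<phi> i) (\<phi> j) = (if i = j then 1 else 0))"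

lemma orthonormal_subset: "orthonormal A \<phi> \<Longrightarrow> A' \<subseteq> A \<Longrightarrow> orthonormal A' \<phi>"
  unfolding orthonormal_def by blast

lemma orthonormal_sum_inner:
  assumes "orthonormal A \<phi>" "finite A" "j \<in> A"
  shows "B (\<Sum>i\<in>A. c i *\<^sub>R \<phi> i) (\<phi> j) = c j"
proof -
  have "B (\<Sum>i\<in>A. c i *\<^sub>R \<phi> i) (\<phi> j) = (\<Sum>i\<in>A. c i * (if i = j then 1 else 0))"
    using assms by (subst sum_left) (auto simp: orthonormal_def scale_left intro!: sum.cong)
  also have "\<dots> = (\<Sum>i\<in>A. if i = j then c i else 0)"
    by (intro sum.cong) auto
  also have "\<dots> = c j" using assms by simp
  finally show ?thesis .
qed

lemma orthonormal_sum_sq: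
  assumes "orthonormal A \<phi>" "finite A"
  shows "B (\<Sum>i\<in>A. c i *\<^sub>R \<phi> i) (\<Sum>i\<in>A. c i *\<^sub>R \<phi> i) = (\<Sum>i\<in>A. (c i)\<^sup>2)"
proof -
  have mem: "(\<Sum>i\<in>A. c i *\<^sub>R \<phi> i) \<in> S" "\<And>i. i \<in> A \<Longrightarrow> \<phi> i \<in> S"
    using assms by (auto simp: orthonormal_def)
  show ?thesis
    using assms mem
    by (subst sum_right) (auto simp: scale_right orthonormal_sum_inner power2_eq_square intro!: sum.cong)
qed

lemma orthonormal_residual:
  assumes "orthonormal A \<phi>" "finite A" "f \<in> S"
  defines "r \<equiv> f - (\<Sum>i\<in>A. B f (\<phi> i) *\<^sub>R \<phi> i)"
  shows "r \<in> S" "j \<in> A \<Longrightarrow> B r (\<phi> j) = 0" "B r r = B f f - (\<Sum>i\<in>A. (B f (\<phi> i))\<^sup>2)"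
proof -
  let ?p = "\<Sum>i\<in>A. B f (\<phi> i) *\<^sub>R \<phi> i"
  have mem: "?p \<in> S" "\<And>i. i \<in> A \<Longrightarrow> \<phi> i \<in> S"
    using assms by (auto simp: orthonormal_def)
  then show "r \<in> S" using assms by auto
  show "j \<in> A \<Longrightarrow> B r (\<phi> j) = 0"
    using assms mem orthonormal_sum_inner[OF assms(1,2), of j "\<lambda>i. B f (\<phi> i)"]
    by (simp add: diff_left)
  have "B f ?p = (\<Sum>i\<in>A. (B f (\<phi> i))\<^sup>2)"
    using assms mem by (subst sum_right) (auto simp: scale_right power2_eq_square)
  then show "B r r = B f f - (\<Sum>i\<in>A. (B f (\<phi> i))\<^sup>2)"
    using assms mem orthonormal_sum_sq[OF assms(1,2), of "\<lambda>i. B f (\<phi> i)"]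
    by (simp add: bilin commute)
qed

lemma bessel:
  assumes "orthonormal A \<phi>" "finite A" "f \<in> S"
  shows "(\<Sum>i\<in>A. (B f (\<phi> i))\<^sup>2) \<le> B f f"
  using orthonormal_residual[OF assms] nonneg by fastforce

lemma bessel_summable:
  assumes "orthonormal UNIV (\<phi> :: nat \<Rightarrow> 'a)" "f \<in> S"
  shows "summable (\<lambda>n. (B f (\<phi> n))\<^sup>2)"
  using bessel[OF orthonormal_subset[OF assms(1)] _ assms(2)]
  by (intro bounded_imp_summable[of _ "B f f"]) auto

text \<open>Otherwise the total squared length of the projections of \<open>card A + 1\<close> of the \<open>\<psi> k\<close>
  would exceed \<open>card A\<close>.\<close>

lemma exists_orthogonal_unit:
  assumes \<psi>: "orthonormal UNIV (\<psi> :: nat \<Rightarrow> 'a)" and \<phi>: "orthonormal A \<phi>" "finite A"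
  shows "\<exists>x\<in>S. B x x = 1 \<and> (\<forall>j\<in>A. B x (\<phi> j) = 0)"
proof -
  define M where "M = Suc (card A)"
  define r where "r k = \<psi> k - (\<Sum>i\<in>A. B (\<psi> k) (\<phi> i) *\<^sub>R \<phi> i)" for k
  have \<psi>S: "\<psi> k \<in> S" for k using \<psi> by (simp add: orthonormal_def)
  note r = orthonormal_residual[OF \<phi> \<psi>S, folded r_def]
  have "(\<Sum>k<M. \<Sum>i\<in>A. (B (\<psi> k) (\<phi> i))\<^sup>2) = (\<Sum>i\<in>A. \<Sum>k<M. (B (\<phi> i) (\<psi> k))\<^sup>2)"
    using \<phi> \<psi>S by (subst sum.swap) (auto simp: orthonormal_def commute intro!: sum.cong)
  also have "\<dots> \<le> (\<Sum>i\<in>A. B (\<phi> i) (\<phi> i))"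
    using \<phi> by (intro sum_mono bessel orthonormal_subset[OF \<psi>]) (auto simp: orthonormal_def)
  also have "\<dots> = real (card A)"
    using \<phi> by (simp add: orthonormal_def)
  finally have "\<exists>k<M. (\<Sum>i\<in>A. (B (\<psi> k) (\<phi> i))\<^sup>2) < 1"
    using sum_mono[of "{..<M}" "\<lambda>_. 1" "\<lambda>k. \<Sum>i\<in>A. (B (\<psi> k) (\<phi> i))\<^sup>2"]
    by (force simp: M_def not_less)
  then obtain k where "(\<Sum>i\<in>A. (B (\<psi> k) (\<phi> i))\<^sup>2) < 1" by blast
  then have pos: "0 < B (r k) (r k)"
    using r(3)[of k] \<psi> by (simp add: orthonormal_def)
  let ?x = "(1 / sqrt (B (r k) (r k))) *\<^sub>R r k"
  have "B ?x ?x = 1" using pos r(1) by (simp add: bilin)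
  moreover have "\<forall>j\<in>A. B ?x (\<phi> j) = 0"
    using r \<phi> by (simp add: scale_left orthonormal_def)
  ultimately show ?thesis using r(1) by blast
qed

lemma expansion_sums:
  assumes "converges (\<lambda>N. \<Sum>n<N. c n *\<^sub>R \<phi> n) f" "\<And>n. \<phi> n \<in> S" "f \<in> S" "g \<in> S"
  shows "(\<lambda>n. c n * B (\<phi> n) g) sums B f g"
  using converges_inner[OF assms(1) _ assms(3,4)] assms
  by (simp add: sums_def sum_left scale_left)

end

locale complete_semi_inner_space = semi_inner_space +
  assumes complete: "\<lbrakk>\<And>n. X n \<in> S; is_cauchy X\<rbrakk> \<Longrightarrow> \<exists>x\<in>S. converges X x"
begin

text \<open>The square of a block of the series is the corresponding block of
  \<open>(c n)\<^sup>2\<close>, so the partial sums are Cauchy. The coefficients pass to the limit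
  because they are eventually constant along the partial sums.\<close>

lemma riesz_fischer:
  assumes \<phi>: "orthonormal UNIV (\<phi> :: nat \<Rightarrow> 'a)" and c: "summable (\<lambda>n. (c n)\<^sup>2)"
  shows "\<exists>g\<in>S. converges (\<lambda>N. \<Sum>n<N. c n *\<^sub>R \<phi> n) g \<and> (\<forall>n. B g (\<phi> n) = c n)"
proof -
  let ?X = "\<lambda>N. \<Sum>n<N. c n *\<^sub>R \<phi> n"
  have \<phi>S: "\<phi> n \<in> S" for n using \<phi> by (simp add: orthonormal_def)
  then have X: "?X N \<in> S" for N by auto
  have cauchy: "is_cauchy ?X"
    unfolding is_cauchy_def
  proof (intro allI impI)
    fix \<epsilon> :: real assume "0 < \<epsilon>"
    then obtain N where N: "\<And>m n. N \<le> m \<Longrightarrow> norm (\<Sum>k=m..<n. (c k)\<^sup>2) < \<epsilon>"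
      using c unfolding summable_Cauchy by blast
    have *: "B (?X m - ?X n) (?X m - ?X n) < \<epsilon>" if "N \<le> n" "n \<le> m" for m n
    proof -
      have "?X m - ?X n = (\<Sum>k=n..<m. c k *\<^sub>R \<phi> k)"
        using that by (simp add: sum_diff_nat_ivl lessThan_atLeast0)
      then show ?thesis
        using N[of n m] that orthonormal_sum_sq[OF orthonormal_subset[OF \<phi>], of "{n..<m}" c]
        by simp
    qed
    have "B (?X m - ?X n) (?X m - ?X n) < \<epsilon>" if "N \<le> m" "N \<le> n" for m n
    proof (cases "n \<le> m")
      case True
      then show ?thesis using * that by blast
    next
      case False
      then have "B (?X n - ?X m) (?X n - ?X m) < \<epsilon>" by (intro *) (use that in auto)
      then show ?thesis by (subst diff_sq_commute[OF X X])
    qed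
    then show "\<exists>N. \<forall>m\<ge>N. \<forall>n\<ge>N. B (?X m - ?X n) (?X m - ?X n) < \<epsilon>"
      by (intro exI[of _ N] allI impI)
  qed
  obtain g where g: "g \<in> S" "converges ?X g"
    by (rule bexE[OF complete[OF X cauchy]])
  have "B g (\<phi> m) = c m" for m
  proof (rule LIMSEQ_unique)
    show "(\<lambda>N. B (?X N) (\<phi> m)) \<longlonglongrightarrow> B g (\<phi> m)"
      using g X \<phi>S by (intro converges_inner)
    have "\<forall>\<^sub>F N in sequentially. B (?X N) (\<phi> m) = c m"
      using eventually_gt_at_top[of m]
      by eventually_elim
        (use orthonormal_subset[OF \<phi>] in \<open>auto intro!: orthonormal_sum_inner\<close>)
    then show "(\<lambda>N. B (?X N) (\<phi> m)) \<longlonglongrightarrow> c m"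
      by (rule tendsto_eventually)
  qed
  then show ?thesis using g by blast
qed

end

text \<open>Boundedness is asked on the unit ball only, which is the form of the estimates for the
  Green operator. Injectivity, again up to null vectors, excludes the eigenvalue 0, so the
  eigenvectors span everything. The sequence \<open>\<psi>\<close> witnesses infinite dimension: the
  construction of eigenvectors never stops and can be indexed by \<open>nat\<close>.\<close>

locale compact_positive_operator = complete_semi_inner_space S B for S :: "'a::real_vector set" and B +
  fixes K :: "'a \<Rightarrow> 'a" and C :: real and \<psi> :: "nat \<Rightarrow> 'a"
  assumes K_mem [simp, intro]: "x \<in> S \<Longrightarrow> K x \<in> S"
    and K_add: "\<lbrakk>x \<in> S; y \<in> S\<rbrakk> \<Longrightarrow> K (x + y) = K x + K y"
    and K_scale: "x \<in> S \<Longrightarrow> K (c *\<^sub>R x) = c *\<^sub>R K x"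
    and K_symmetric: "\<lbrakk>x \<in> S; y \<in> S\<rbrakk> \<Longrightarrow> B (K x) y = B (K y) x"
    and K_nonneg: "x \<in> S \<Longrightarrow> 0 \<le> B (K x) x"
    and K_bounded_unit: "\<lbrakk>x \<in> S; B x x \<le> 1\<rbrakk> \<Longrightarrow> B (K x) (K x) \<le> C"
    and K_injective: "\<lbrakk>x \<in> S; B (K x) (K x) = 0\<rbrakk> \<Longrightarrow> B x x = 0"
    and K_compact: "\<And>X :: nat \<Rightarrow> 'a. (\<And>n. X n \<in> S \<and> B (X n) (X n) \<le> 1) \<Longrightarrow>
          \<exists>r :: nat \<Rightarrow> nat. strict_mono r \<and> is_cauchy (\<lambda>n. K (X (r n)))"
    and infinite_dimensional: "orthonormal UNIV \<psi>"
begin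

text \<open>Brings in the Cauchy-Schwarz inequality for the energy form, which converts bounds on
  the quadratic form of \<open>K\<close> into bounds on \<open>K x\<close> itself.\<close>

sublocale energy: semi_inner_space S "\<lambda>x y. B (K x) y"
  by unfold_locales
    (auto simp: subspace_S K_symmetric K_nonneg K_add K_scale add_left scale_left)

lemma K_diff: "\<lbrakk>x \<in> S; y \<in> S\<rbrakk> \<Longrightarrow> K (x - y) = K x - K y"
  using K_add[of "x - y" y] by (simp add: algebra_simps)

text \<open>Homogeneity. A null vector has all its multiples in the unit ball, so its image must be
  null as well.\<close>

lemma K_bounded:
  assumes x: "x \<in> S"
  shows "B (K x) (K x) \<le> C * B x x"
proof -
  have scaled: "t\<^sup>2 * B (K x) (K x) \<le> C" if "t\<^sup>2 * B x x \<le> 1" for t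
    using K_bounded_unit[of "t *\<^sub>R x"] that x by (simp add: K_scale scale_sq)
  show ?thesis
  proof (cases "B x x = 0")
    case True
    have "B (K x) (K x) = 0"
    proof (rule ccontr)
      assume "B (K x) (K x) \<noteq> 0"
      then have "0 < B (K x) (K x)" using nonneg[of "K x"] x by simp
      then show False
        using scaled[of "sqrt ((\<bar>C\<bar> + 1) / B (K x) (K x))"] True by simp
    qed
    then show ?thesis using True by simp
  next
    case False
    then have "0 < B x x" using nonneg[of x] x by simp
    then show ?thesis
      using scaled[of "1 / sqrt (B x x)"] by (simp add: power_divide field_simps)
  qed
qed

text \<open>The eigenvalue equation modulo null vectors. The vector is not normalised here and could
  itself be null.\<close>

definition eigenpair :: "real \<Rightarrow> 'a \<Rightarrow> bool" where
  "eigenpair \<mu> x \<longleftrightarrow> x \<in> S \<and> 0 < \<mu> \<and> B (K x - \<mu> *\<^sub>R x) (K x - \<mu> *\<^sub>R x) = 0"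

lemma eigenpair_inner:
  assumes "eigenpair \<mu> x" "y \<in> S"
  shows "B (K x) y = \<mu> * B x y"
  using null_left[of "K x - \<mu> *\<^sub>R x" y] assms
  by (auto simp: eigenpair_def diff_left scale_left)

text \<open>Cauchy-Schwarz in the energy form for \<open>x\<close> and \<open>K x\<close> bounds the
  square of \<open>B (K x) (K x)\<close> by \<open>B (K x) x * B (K (K x)) (K x)\<close>. Invariance
  of \<open>V\<close> allows the hypothesis to be applied to \<open>K x\<close> in the second
  factor, and one factor \<open>B (K x) (K x)\<close> cancels.\<close>

lemma K_sq_le:
  assumes V: "subspace V" "V \<subseteq> S" "\<And>x. x \<in> V \<Longrightarrow> K x \<in> V"
    and s: "\<And>x. x \<in> V \<Longrightarrow> B (K x) x \<le> s * B x x" and x: "x \<in> V"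
  shows "B (K x) (K x) \<le> s * B (K x) x"
proof (cases "B (K x) (K x) = 0")
  case True
  have "0 = B (K x) x"
    using null_left[of "K x" x] True V(2) x by auto
  then show ?thesis using True by simp
next
  case False
  have xS: "x \<in> S" "K x \<in> S" using V x by auto
  then have pos: "0 < B (K x) (K x)" using False nonneg[of "K x"] by simp
  have "(B (K x) (K x))\<^sup>2 \<le> B (K x) x * B (K (K x)) (K x)"
    using energy.cauchy_schwarz[of x "K x"] xS by simp
  also have "\<dots> \<le> B (K x) x * (s * B (K x) (K x))"
    using s[of "K x"] V x K_nonneg[of x] xS by (intro mult_left_mono) auto
  finally have "B (K x) (K x) * B (K x) (K x) \<le> (s * B (K x) x) * B (K x) (K x)"
    by (simp add: power2_eq_square ac_simps)
  then show ?thesis using pos by simp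
qed

text \<open>The variational principle. Along a maximising sequence \<open>X\<close> of unit vectors
  with supremum \<open>s\<close>, \<open>K_sq_le\<close> bounds the square of
  \<open>K (X n) - s X n\<close> by \<open>s\<^sup>2 - s * B (K (X n)) (X n)\<close>, which tends to
  0. Compactness gives a limit \<open>y\<close> of \<open>K (X n)\<close> along a subsequence, hence
  also of \<open>s X n\<close>; so \<open>y\<close> stays in \<open>V\<close> and is an
  eigenvector.\<close>

lemma exists_max_eigenvector:
  assumes V: "subspace V" "V \<subseteq> S" "\<And>x. x \<in> V \<Longrightarrow> K x \<in> V"
    and closed: "\<And>X x. \<lbrakk>\<And>n. X n \<in> V; converges X x; x \<in> S\<rbrakk> \<Longrightarrow> x \<in> V"
    and ne: "\<exists>x\<in>V. B x x = 1"
  shows "\<exists>\<mu> x. eigenpair \<mu> x \<and> x \<in> V \<and> B x x = 1 \<and> (\<forall>y\<in>V. B (K y) y \<le> \<mu> * B y y)"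
proof -
  define Q where "Q = (\<lambda>x. B (K x) x) ` {x \<in> V. B x x = 1}"
  define s where "s = Sup Q"
  have bdd: "bdd_above Q"
  proof (rule bdd_aboveI)
    fix q assume "q \<in> Q"
    then obtain x where x: "x \<in> V" "B x x = 1" "q = B (K x) x" by (auto simp: Q_def)
    have "q\<^sup>2 \<le> C"
      using cauchy_schwarz[of "K x" x] K_bounded[of x] x V by auto
    then show "q \<le> sqrt C" by (rule real_le_rsqrt)
  qed
  have Q_ne: "Q \<noteq> {}" using ne by (auto simp: Q_def)
  have s_ge: "B (K x) x \<le> s * B x x" if "x \<in> V" for x
  proof (cases "B x x = 0")
    case True
    then have "B (K x) x = 0"
      using null_left[of x "K x"] commute[of x "K x"] V that by auto
    then show ?thesis using True by simp
  next
    case False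
    have xS: "x \<in> S" using V that by auto
    then have pos: "0 < B x x" using False nonneg[of x] by simp
    let ?c = "1 / sqrt (B x x)"
    have "B (K (?c *\<^sub>R x)) (?c *\<^sub>R x) \<in> Q"
      unfolding Q_def using V(1) that pos xS
      by (intro imageI CollectI conjI subspace_scale) (auto simp: bilin)
    then have "B (K (?c *\<^sub>R x)) (?c *\<^sub>R x) \<le> s"
      unfolding s_def using bdd by (rule cSup_upper)
    then show ?thesis using xS pos by (simp add: K_scale bilin field_simps)
  qed
  have sq: "B (K x) (K x) \<le> s * B (K x) x" if "x \<in> V" for x
    by (rule K_sq_le[OF V]) (use s_ge that in auto)
  \<comment> \<open>Injectivity makes \<open>K x\<close> non-null for a unit vector
    \<open>x\<close>, and then \<open>sq\<close> excludes \<open>B (K x) x = 0\<close>.\<close>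
  have s_pos: "0 < s"
  proof -
    obtain x where x: "x \<in> V" "B x x = 1" using ne by blast
    then have xS: "x \<in> S" using V by auto
    have "B (K x) (K x) \<noteq> 0" using K_injective x xS by auto
    then have "B (K x) x \<noteq> 0" using sq[OF x(1)] nonneg[of "K x"] xS by auto
    then have "0 < B (K x) x" using K_nonneg[OF xS] by simp
    then show ?thesis using s_ge[OF x(1)] x by simp
  qed
  have "\<exists>X. \<forall>n. X n \<in> V \<and> B (X n) (X n) = 1 \<and> s - 1 / real (Suc n) < B (K (X n)) (X n)"
  proof (rule choice, rule allI)
    fix n :: nat
    have "\<exists>q\<in>Q. s - 1 / real (Suc n) < q"
      unfolding s_def using less_cSup_iff[OF Q_ne bdd, of "Sup Q - 1 / real (Suc n)"] by simp
    then show "\<exists>x. x \<in> V \<and> B x x = 1 \<and> s - 1 / real (Suc n) < B (K x) x"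
      by (auto simp: Q_def)
  qed
  then obtain X where X: "\<And>n. X n \<in> V" "\<And>n. B (X n) (X n) = 1"
    "\<And>n. s - 1 / real (Suc n) < B (K (X n)) (X n)" by blast
  have XS: "X n \<in> S" for n using X V by auto
  have lim: "(\<lambda>n. B (K (X n)) (X n)) \<longlonglongrightarrow> s"
  proof (rule tendsto_sandwich[OF _ _ _ tendsto_const])
    show "\<forall>\<^sub>F n in sequentially. s - 1 / real (Suc n) \<le> B (K (X n)) (X n)"
      using X(3) by (simp add: less_imp_le)
    show "\<forall>\<^sub>F n in sequentially. B (K (X n)) (X n) \<le> s"
      using s_ge[OF X(1)] X(2) by simp
    show "(\<lambda>n. s - 1 / real (Suc n)) \<longlonglongrightarrow> s"
      using tendsto_diff[OF tendsto_const LIMSEQ_inverse_real_of_nat, of s]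
      by (simp add: inverse_eq_divide)
  qed
  obtain r where r: "strict_mono r" "is_cauchy (\<lambda>n. K (X (r n)))"
    using K_compact[of X] XS X by auto
  then obtain y where y: "y \<in> S" "converges (\<lambda>n. K (X (r n))) y"
    using complete[of "\<lambda>n. K (X (r n))"] XS by auto
  have limr: "(\<lambda>n. B (K (X (r n))) (X (r n))) \<longlonglongrightarrow> s"
    using LIMSEQ_subseq_LIMSEQ[OF lim r(1)] by (simp add: o_def)
  have null: "(\<lambda>n. B (K (X (r n)) - s *\<^sub>R X (r n)) (K (X (r n)) - s *\<^sub>R X (r n))) \<longlonglongrightarrow> 0"
  proof (rule tendsto_sandwich[OF _ _ tendsto_const])
    have "B (K (X n) - s *\<^sub>R X n) (K (X n) - s *\<^sub>R X n)
        = B (K (X n)) (K (X n)) - 2 * s * B (K (X n)) (X n) + s\<^sup>2" for n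
      using XS X(2) commute[of "X n" "K (X n)"]
      by (simp add: bilin power2_eq_square algebra_simps)
    then have "B (K (X n) - s *\<^sub>R X n) (K (X n) - s *\<^sub>R X n) \<le> s\<^sup>2 - s * B (K (X n)) (X n)" for n
      using sq[OF X(1), of n] by simp
    then show "\<forall>\<^sub>F n in sequentially. B (K (X (r n)) - s *\<^sub>R X (r n)) (K (X (r n)) - s *\<^sub>R X (r n))
        \<le> s\<^sup>2 - s * B (K (X (r n))) (X (r n))" by simp
    show "(\<lambda>n. s\<^sup>2 - s * B (K (X (r n))) (X (r n))) \<longlonglongrightarrow> 0"
      using tendsto_diff[OF tendsto_const tendsto_mult[OF tendsto_const limr], of "s\<^sup>2" s]
      by (simp add: power2_eq_square)
  qed (use XS in \<open>auto intro!: nonneg always_eventually\<close>)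
  have conv_sX: "converges (\<lambda>n. s *\<^sub>R X (r n)) y"
    by (rule converges_add_null[OF y(2) null]) (use XS y in auto)
  have "y \<in> V"
    using closed[OF _ conv_sX y(1)] V(1) X(1) by (auto intro: subspace_scale)
  \<comment> \<open>The sequence \<open>s K (X (r n))\<close> is evaluated twice: as the image of
    \<open>s X (r n)\<close>, by continuity of \<open>K\<close>, and as a multiple of
    \<open>K (X (r n))\<close>. Comparing the limits gives the eigenvalue equation for
    \<open>y\<close>.\<close>
  have "converges (\<lambda>n. s *\<^sub>R K (X (r n))) (K y)"
    unfolding converges_def
  proof (rule tendsto_sandwich[OF _ _ tendsto_const])
    show "\<forall>\<^sub>F n in sequentially. B (s *\<^sub>R K (X (r n)) - K y) (s *\<^sub>R K (X (r n)) - K y)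
        \<le> C * B (s *\<^sub>R X (r n) - y) (s *\<^sub>R X (r n) - y)"
      using K_bounded[of "s *\<^sub>R X (r n) - y" for n] XS y
      by (intro always_eventually allI) (metis K_diff K_scale mem(3) mem(4))
    show "(\<lambda>n. C * B (s *\<^sub>R X (r n) - y) (s *\<^sub>R X (r n) - y)) \<longlonglongrightarrow> 0"
      using conv_sX tendsto_mult_right_zero unfolding converges_def by blast
  qed (use XS y in \<open>auto intro!: nonneg always_eventually\<close>)
  moreover have "converges (\<lambda>n. s *\<^sub>R K (X (r n))) (s *\<^sub>R y)"
  proof -
    have "B (s *\<^sub>R K (X n) - s *\<^sub>R y) (s *\<^sub>R K (X n) - s *\<^sub>R y) = s\<^sup>2 * B (K (X n) - y) (K (X n) - y)" for n
      using XS y by (simp add: bilin power2_eq_square algebra_simps)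
    then show ?thesis
      using y(2) tendsto_mult_right_zero unfolding converges_def by simp
  qed
  ultimately have Ky: "B (K y - s *\<^sub>R y) (K y - s *\<^sub>R y) = 0"
    using XS y by (intro converges_unique[of "\<lambda>n. s *\<^sub>R K (X (r n))"]) auto
  \<comment> \<open>If \<open>y\<close> were null, \<open>K (X (r n))\<close> would tend to 0, and
    with it the quadratic form at the unit vectors \<open>X (r n)\<close>, whose limit is
    \<open>s > 0\<close>.\<close>
  have "B y y \<noteq> 0"
  proof
    assume 0: "B y y = 0"
    have lim0: "(\<lambda>n. B (K (X (r n))) (K (X (r n)))) \<longlonglongrightarrow> 0"
    proof -
      have "B (K (X n) - y) (K (X n) - y) = B (K (X n)) (K (X n))" for n
        using null_left[OF _ _ 0, of "K (X n)"] commute[of "K (X n)" y] 0 XS y by (simp add: bilin)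
      then show ?thesis using y(2) by (simp add: converges_def)
    qed
    have "(\<lambda>n. (B (K (X (r n))) (X (r n)))\<^sup>2) \<longlonglongrightarrow> 0"
    proof (rule tendsto_sandwich[OF _ _ tendsto_const lim0])
      show "\<forall>\<^sub>F n in sequentially. (B (K (X (r n))) (X (r n)))\<^sup>2 \<le> B (K (X (r n))) (K (X (r n)))"
        using cauchy_schwarz[of "K (X (r n))" "X (r n)" for n] XS X(2) by simp
    qed simp
    moreover have "(\<lambda>n. (B (K (X (r n))) (X (r n)))\<^sup>2) \<longlonglongrightarrow> s\<^sup>2"
      using limr by (intro tendsto_power)
    ultimately show False using LIMSEQ_unique s_pos by fastforce
  qed
  then have pos: "0 < B y y" using nonneg y by (simp add: order_less_le)
  define x where "x = (1 / sqrt (B y y)) *\<^sub>R y"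
  have "x \<in> V" "x \<in> S" unfolding x_def using \<open>y \<in> V\<close> V by (auto intro: subspace_scale)
  moreover have "B x x = 1" unfolding x_def using pos y by (simp add: bilin)
  moreover have "eigenpair s x"
  proof -
    have "K x - s *\<^sub>R x = (1 / sqrt (B y y)) *\<^sub>R (K y - s *\<^sub>R y)"
      unfolding x_def using y by (simp add: K_scale algebra_simps)
    then show ?thesis
      using Ky y s_pos \<open>x \<in> S\<close> unfolding eigenpair_def
      by (metis K_mem mem(3) mem(4) mult_zero_right scale_left scale_right)
  qed
  ultimately show ?thesis using s_ge by blast
qed

text \<open>The orthogonal complement of finitely many eigenvectors is closed, is invariant since
  \<open>K\<close> is symmetric, and contains a unit vector since the dimension is infinite.
  Maximality over the complement is recorded because both the ordering of the eigenvalues and the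
  completeness of the system rest on it.\<close>

lemma exists_next_eigenvector:
  assumes \<phi>: "orthonormal {..<n::nat} \<phi>" and ev: "\<And>j. j < n \<Longrightarrow> \<exists>\<mu>. eigenpair \<mu> (\<phi> j)"
  shows "\<exists>x. B x x = 1 \<and> (\<forall>j<n. B x (\<phi> j) = 0) \<and>
    (\<exists>\<mu>. eigenpair \<mu> x \<and> (\<forall>y\<in>S. (\<forall>j<n. B y (\<phi> j) = 0) \<longrightarrow> B (K y) y \<le> \<mu> * B y y))"
proof -
  define V where "V = {x\<in>S. \<forall>j<n. B x (\<phi> j) = 0}"
  have \<phi>S: "\<phi> j \<in> S" if "j < n" for j using \<phi> that by (simp add: orthonormal_def)
  have "\<exists>\<mu> x. eigenpair \<mu> x \<and> x \<in> V \<and> B x x = 1 \<and> (\<forall>y\<in>V. B (K y) y \<le> \<mu> * B y y)"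
  proof (rule exists_max_eigenvector)
    show "subspace V"
      using \<phi>S by (auto simp: subspace_def V_def add_left scale_left zero_left)
    show "V \<subseteq> S" by (auto simp: V_def)
    show "K x \<in> V" if "x \<in> V" for x
    proof -
      have "B (K x) (\<phi> j) = 0" if j: "j < n" for j
      proof -
        obtain \<mu> where "eigenpair \<mu> (\<phi> j)" using ev j by blast
        then have "B (K (\<phi> j)) x = \<mu> * B (\<phi> j) x"
          using \<open>x \<in> V\<close> by (intro eigenpair_inner) (auto simp: V_def)
        then show ?thesis
          using \<open>x \<in> V\<close> \<phi>S j by (simp add: V_def K_symmetric[of x] commute[of "\<phi> j" x])
      qed
      then show ?thesis using that by (auto simp: V_def)
    qed
    show "x \<in> V" if "\<And>n. X n \<in> V" "converges X x" "x \<in> S" for X x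
    proof -
      have "B x (\<phi> j) = 0" if "j < n" for j
      proof -
        have "(\<lambda>n. B (X n) (\<phi> j)) \<longlonglongrightarrow> B x (\<phi> j)"
          using \<open>converges X x\<close> \<open>\<And>n. X n \<in> V\<close> \<open>x \<in> S\<close> \<phi>S[OF that]
          by (intro converges_inner) (auto simp: V_def)
        then show ?thesis
          using \<open>\<And>n. X n \<in> V\<close> that LIMSEQ_unique[OF _ tendsto_const] by (simp add: V_def)
      qed
      then show ?thesis using that by (simp add: V_def)
    qed
    show "\<exists>x\<in>V. B x x = 1"
      using exists_orthogonal_unit[OF infinite_dimensional \<phi> finite_lessThan] by (auto simp: V_def)
  qed
  then obtain \<mu> x where "eigenpair \<mu> x" "x \<in> V" "B x x = 1" "\<forall>y\<in>V. B (K y) y \<le> \<mu> * B y y"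
    by blast
  then show ?thesis by (intro exI[of _ x]) (auto simp: V_def)
qed

theorem spectral_theorem:
  obtains \<mu> :: "nat \<Rightarrow> real" and \<phi> :: "nat \<Rightarrow> 'a"
  where "\<And>n. eigenpair (\<mu> n) (\<phi> n)" "decseq \<mu>" "\<mu> \<longlonglongrightarrow> 0" "orthonormal UNIV \<phi>"
    "\<And>f. f \<in> S \<Longrightarrow> converges (\<lambda>N. \<Sum>n<N. B f (\<phi> n) *\<^sub>R \<phi> n) f"
proof -
  define P where "P \<phi> n x \<longleftrightarrow> B x x = 1 \<and> (\<forall>j<n. B x (\<phi> j) = 0) \<and>
    (\<exists>\<mu>. eigenpair \<mu> x \<and> (\<forall>y\<in>S. (\<forall>j<n. B y (\<phi> j) = 0) \<longrightarrow> B (K y) y \<le> \<mu> * B y y))"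
    for \<phi> and n :: nat and x
  have orth: "orthonormal A \<phi>" if P: "\<And>j. j \<in> A \<Longrightarrow> P \<phi> j (\<phi> j)" for A \<phi>
    unfolding orthonormal_def
  proof (intro conjI ballI)
    show mem: "\<phi> i \<in> S" if "i \<in> A" for i using P[OF that] by (auto simp: P_def eigenpair_def)
    fix i j assume "i \<in> A" "j \<in> A"
    then show "B (\<phi> i) (\<phi> j) = (if i = j then 1 else 0)"
      using P[of i] P[of j] commute[of "\<phi> i" "\<phi> j"] mem
      by (cases i j rule: linorder_cases) (auto simp: P_def)
  qed
  have "\<exists>\<phi>. \<forall>n. P \<phi> n (\<phi> n)"
  \<comment> \<open>\<open>P \<phi> n x\<close> looks at \<open>\<phi>\<close> below
    \<open>n\<close> only, so the sequence can be chosen by well-founded recursion.\<close>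
  proof (rule dependent_wf_choice[of less_than])
    show "P f n x = P g n x" if "\<And>z. (z, n) \<in> less_than \<Longrightarrow> f z = g z" for f g n x
      using that by (simp add: P_def)
    show "\<exists>x. P \<phi> n x" if "\<And>j. (j, n) \<in> less_than \<Longrightarrow> P \<phi> j (\<phi> j)" for n \<phi>
    proof -
      have P: "P \<phi> j (\<phi> j)" if "j < n" for j using that \<open>\<And>j. (j, n) \<in> less_than \<Longrightarrow> P \<phi> j (\<phi> j)\<close> by simp
      have "orthonormal {..<n} \<phi>" using orth[of "{..<n}" \<phi>] P by simp
      moreover have "\<exists>\<mu>. eigenpair \<mu> (\<phi> j)" if "j < n" for j
        using P[OF that] unfolding P_def by blast
      ultimately show ?thesis
        unfolding P_def by (rule exists_next_eigenvector)
    qed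
  qed simp
  then obtain \<phi> where \<phi>: "\<And>n. P \<phi> n (\<phi> n)" by blast
  then have "\<forall>n. \<exists>\<mu>. eigenpair \<mu> (\<phi> n) \<and> (\<forall>y\<in>S. (\<forall>j<n. B y (\<phi> j) = 0) \<longrightarrow> B (K y) y \<le> \<mu> * B y y)"
    by (simp add: P_def)
  then obtain \<mu> where ev: "\<And>n. eigenpair (\<mu> n) (\<phi> n)"
    and max: "\<And>n y. \<lbrakk>y \<in> S; \<forall>j<n. B y (\<phi> j) = 0\<rbrakk> \<Longrightarrow> B (K y) y \<le> \<mu> n * B y y"
    by metis
  have on: "orthonormal UNIV \<phi>" using orth \<phi> by blast
  have \<phi>S: "\<phi> n \<in> S" for n using on by (simp add: orthonormal_def)
  have \<phi>\<phi>: "B (\<phi> i) (\<phi> j) = (if i = j then 1 else 0)" for i j using on by (simp add: orthonormal_def)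
  have \<mu>_pos: "0 < \<mu> n" for n using ev by (simp add: eigenpair_def)
  have K\<phi>: "B (K (\<phi> n)) y = \<mu> n * B (\<phi> n) y" if "y \<in> S" for n y
    using eigenpair_inner[OF ev that] .
  have dec: "decseq \<mu>"
  proof (rule decseq_SucI)
    fix n show "\<mu> (Suc n) \<le> \<mu> n"
      using max[of "\<phi> (Suc n)" n] K\<phi>[of "\<phi> (Suc n)" "Suc n"] \<phi>\<phi> \<phi>S by simp
  qed
  have lim: "\<mu> \<longlonglongrightarrow> 0"
  proof -
    obtain r where r: "strict_mono r" "is_cauchy (\<lambda>n. K (\<phi> (r n)))"
      using K_compact[of \<phi>] \<phi>S \<phi>\<phi> by auto
    \<comment> \<open>Orthogonality keeps the images apart, so a Cauchy subsequence of images forces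
      arbitrarily small eigenvalues; monotonicity then handles the whole sequence.\<close>
    have KK: "B (K (\<phi> i) - K (\<phi> j)) (K (\<phi> i) - K (\<phi> j)) = (\<mu> i)\<^sup>2 + (\<mu> j)\<^sup>2" if "i \<noteq> j" for i j
    proof -
      have "B (K (\<phi> i)) (K (\<phi> j)) = \<mu> i * (\<mu> j * B (\<phi> i) (\<phi> j))" for i j
        using K\<phi> \<phi>S by (metis K_mem commute)
      then show ?thesis
        using that \<phi>\<phi> \<phi>S by (simp add: bilin power2_eq_square)
    qed
    show ?thesis
    proof (rule LIMSEQ_I)
      fix \<epsilon> :: real assume "0 < \<epsilon>"
      then obtain N where N: "\<And>m n. N \<le> m \<Longrightarrow> N \<le> n \<Longrightarrow>
          B (K (\<phi> (r m)) - K (\<phi> (r n))) (K (\<phi> (r m)) - K (\<phi> (r n))) < \<epsilon>\<^sup>2"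
        using r(2) unfolding is_cauchy_def by (meson zero_less_power)
      have "r N \<noteq> r (Suc N)" using r(1) by (simp add: strict_mono_eq)
      then have "(\<mu> (r N))\<^sup>2 < \<epsilon>\<^sup>2"
        using N[of N "Suc N"] KK[of "r N" "r (Suc N)"] zero_le_power2[of "\<mu> (r (Suc N))"] by linarith
      then have "\<mu> (r N) < \<epsilon>" using \<open>0 < \<epsilon>\<close> power_less_imp_less_base by fastforce
      then have "\<forall>n\<ge>r N. norm (\<mu> n - 0) < \<epsilon>"
        using \<mu>_pos decseqD[OF dec] by (smt (verit) real_norm_def)
      then show "\<exists>M. \<forall>n\<ge>M. norm (\<mu> n - 0) < \<epsilon>" by blast
    qed
  qed
  have "converges (\<lambda>N. \<Sum>n<N. B f (\<phi> n) *\<^sub>R \<phi> n) f" if f: "f \<in> S" for f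
  proof -
    obtain g where g: "g \<in> S" "converges (\<lambda>N. \<Sum>n<N. B f (\<phi> n) *\<^sub>R \<phi> n) g"
      and gn: "\<And>n. B g (\<phi> n) = B f (\<phi> n)"
      using riesz_fischer[OF on bessel_summable[OF on f]] by blast
    \<comment> \<open>The residual is orthogonal to every \<open>\<phi> n\<close>, so every
      maximality bound applies to it and \<open>B (K ?r) ?r\<close> is at most
      \<open>\<mu> n * B ?r ?r\<close>, which tends to 0. The energy form then makes
      \<open>K ?r\<close> null, and injectivity makes \<open>?r\<close> null.\<close>
    let ?r = "g - f"
    have rS: "?r \<in> S" using f g by auto
    have orth_r: "B ?r (\<phi> n) = 0" for n using f g gn \<phi>S by (simp add: diff_left)
    have "B (K ?r) ?r \<le> 0"
    proof (rule LIMSEQ_le_const)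
      show "(\<lambda>n. \<mu> n * B ?r ?r) \<longlonglongrightarrow> 0" using tendsto_mult_left_zero[OF lim] .
      show "\<exists>N. \<forall>n\<ge>N. B (K ?r) ?r \<le> \<mu> n * B ?r ?r"
        using max[OF rS] orth_r by blast
    qed
    then have "B (K ?r) ?r = 0" using K_nonneg[OF rS] by simp
    then have "B (K ?r) (K ?r) = 0" 
      using energy.null_left[OF rS K_mem[OF rS]] by simp
    then have 0: "B ?r ?r = 0" using K_injective[OF rS] by blast
    then show ?thesis
      using converges_equiv[OF g(2)] f g \<phi>S by blast
  qed
  then show thesis using that ev dec lim on by blast
qed

end

section \<open>The space of square integrable functions\<close>

text \<open>The carrier of the locales lives in a \<open>real_vector\<close> type. Applied twice, on
  top of the pointwise addition of \<open>Function_Algebras\<close>, this instance covers curried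
  graph functions.\<close>

instantiation "fun" :: (type, real_vector) real_vector
begin

definition "c *\<^sub>R f = (\<lambda>x. c *\<^sub>R f x)"

instance
  by standard (simp_all add: scaleR_fun_def fun_eq_iff scaleR_add_right scaleR_add_left)

end

lemma scaleR_fun_apply [simp]: "(c *\<^sub>R f) x = c *\<^sub>R f x"
  by (simp add: scaleR_fun_def)

lemma sum_fun_apply: "(\<Sum>i\<in>A. f i) x = (\<Sum>i\<in>A. f i x)"
  by (induction A rule: infinite_finite_induct) auto

section \<open>Square integrable functions on a measure space and their completeness\<close>

definition square_integrable :: "'a measure \<Rightarrow> ('a \<Rightarrow> real) \<Rightarrow> bool" where
  "square_integrable M f \<longleftrightarrow> f \<in> borel_measurable M \<and> integrable M (\<lambda>x. (f x)\<^sup>2)"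

lemma square_integrable_mult:
  assumes "square_integrable M f" "square_integrable M g"
  shows "integrable M (\<lambda>x. f x * g x)"
proof (rule Bochner_Integration.integrable_bound)
  show "integrable M (\<lambda>x. (f x)\<^sup>2 + (g x)\<^sup>2)"
    using assms by (auto simp: square_integrable_def)
  have "\<bar>a * b\<bar> \<le> a\<^sup>2 + b\<^sup>2" for a b :: real
    using sum_squares_bound[of "\<bar>a\<bar>" "\<bar>b\<bar>"] mult_nonneg_nonneg[of "\<bar>a\<bar>" "\<bar>b\<bar>"]
    unfolding abs_mult power2_abs by linarith
  then show "AE x in M. norm (f x * g x) \<le> norm ((f x)\<^sup>2 + (g x)\<^sup>2)"
    by simp
qed (use assms in \<open>auto simp: square_integrable_def\<close>)

lemma square_integrable_add:
  assumes "square_integrable M f" "square_integrable M g"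
  shows "square_integrable M (\<lambda>x. f x + g x)"
  using assms square_integrable_mult[OF assms]
  by (auto simp: square_integrable_def power2_sum mult.assoc)

lemma square_integrable_cmult:
  "square_integrable M f \<Longrightarrow> square_integrable M (\<lambda>x. c * f x)"
  by (auto simp: square_integrable_def power_mult_distrib)

lemma square_integrable_diff:
  assumes "square_integrable M f" "square_integrable M g"
  shows "square_integrable M (\<lambda>x. f x - g x)"
  using square_integrable_add[OF assms(1) square_integrable_cmult[OF assms(2), of "-1"]] by simp

text \<open>A subsequence with \<open>\<integral>(F (r (k+1)) - F (r k))\<^sup>2 < 4\<^sup>-\<^sup>k\<close> converges pointwise almost
  everywhere because \<open>\<Sum>k. 2\<^sup>k (F (r (k+1)) - F (r k))\<^sup>2\<close> is integrable; Fatou's lemma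
  turns this into convergence in the mean.\<close>

lemma square_integrable_complete:
  assumes F: "\<And>n. square_integrable M (F n)"
    and cauchy: "\<And>\<epsilon>. 0 < \<epsilon> \<Longrightarrow> \<exists>N. \<forall>m\<ge>N. \<forall>n\<ge>N. (\<integral>x. (F m x - F n x)\<^sup>2 \<partial>M) < \<epsilon>"
  shows "\<exists>f. square_integrable M f \<and> (\<lambda>n. \<integral>x. (F n x - f x)\<^sup>2 \<partial>M) \<longlonglongrightarrow> 0"
proof -
  have Fm [measurable]: "F n \<in> borel_measurable M" for n using F by (simp add: square_integrable_def)
  have Fi: "integrable M (\<lambda>x. (F m x - F n x)\<^sup>2)" for m n
    using square_integrable_diff[OF F F] by (simp add: square_integrable_def)
  have "\<forall>k. \<exists>N. \<forall>m\<ge>N. \<forall>n\<ge>N. (\<integral>x. (F m x - F n x)\<^sup>2 \<partial>M) < (1/4)^k"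
    using cauchy by simp
  then obtain N where N: "\<And>k m n. N k \<le> m \<Longrightarrow> N k \<le> n \<Longrightarrow> (\<integral>x. (F m x - F n x)\<^sup>2 \<partial>M) < (1/4)^k"
    by metis
  \<comment> \<open>The sum dominates \<open>N k\<close> and makes \<open>r\<close> monotone; the
    summand \<open>k\<close> makes \<open>r\<close> unbounded.\<close>
  define r where "r k = k + (\<Sum>i\<le>k. N i)" for k
  have r: "N k \<le> r k" "r k \<le> r (Suc k)" "k \<le> r k" for k
    using member_le_sum[of k "{..k}" N] by (auto simp: r_def)
  define d where "d k x = F (r (Suc k)) x - F (r k) x" for k x
  have [measurable]: "d k \<in> borel_measurable M" for k unfolding d_def by measurable
  have d_int: "(\<integral>x. (d k x)\<^sup>2 \<partial>M) \<le> (1/4)^k" for k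
    using N[of k "r (Suc k)" "r k"] r[of k] by (simp add: d_def)
  have d_nn: "(\<integral>\<^sup>+x. ennreal (2^k * (d k x)\<^sup>2) \<partial>M) \<le> ennreal ((1/2)^k)" for k
  proof -
    have "(\<integral>\<^sup>+x. ennreal (2^k * (d k x)\<^sup>2) \<partial>M) = ennreal (\<integral>x. 2^k * (d k x)\<^sup>2 \<partial>M)"
      using Fi by (intro nn_integral_eq_integral) (auto simp: d_def)
    also have "\<dots> = ennreal (2^k * (\<integral>x. (d k x)\<^sup>2 \<partial>M))" by simp
    also have "\<dots> \<le> ennreal (2^k * (1/4)^k)"
      using d_int by (intro ennreal_leI mult_left_mono) auto
    also have "2^k * (1/4)^k = ((1/2)^k :: real)"
      by (simp flip: power_mult_distrib)
    finally show ?thesis .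
  qed
  have "(\<integral>\<^sup>+x. (\<Sum>k. ennreal (2^k * (d k x)\<^sup>2)) \<partial>M) = (\<Sum>k. \<integral>\<^sup>+x. ennreal (2^k * (d k x)\<^sup>2) \<partial>M)"
    by (rule nn_integral_suminf) measurable
  also have "\<dots> \<le> (\<Sum>k. ennreal ((1/2)^k))"
    using d_nn by (intro suminf_le) auto
  also have "\<dots> = ennreal (\<Sum>k. (1/2)^k)"
    by (intro suminf_ennreal2) (auto simp: summable_geometric)
  also have "\<dots> < \<infinity>" by simp
  finally have "AE x in M. (\<Sum>k. ennreal (2^k * (d k x)\<^sup>2)) \<noteq> \<infinity>"
    by (intro nn_integral_PInf_AE) auto
  then have conv: "AE x in M. (\<lambda>k. F (r k) x) \<longlonglongrightarrow> lim (\<lambda>k. F (r k) x)"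
  proof eventually_elim
    case (elim x)
    have "summable (\<lambda>k. 2^k * (d k x)\<^sup>2)"
      using elim by (intro summable_suminf_not_top) auto
    then have "summable (\<lambda>k. 2^k * (d k x)\<^sup>2 + (1/2)^k)"
      by (intro summable_add) (auto simp: summable_geometric)
    \<comment> \<open>Completing the square: the weighted squares together with a geometric series
      dominate the differences themselves, so the telescoping series converges absolutely.\<close>
    moreover have "norm (d k x) \<le> 2^k * (d k x)\<^sup>2 + (1/2)^k" for k
    proof -
      have "0 \<le> 2^k * (\<bar>d k x\<bar> - (1/2)^k)\<^sup>2" by simp
      also have "\<dots> = 2^k * (d k x)\<^sup>2 - 2 * (2^k * (1/2)^k) * \<bar>d k x\<bar> + (2^k * (1/2)^k) * (1/2)^k"
        by (simp add: power2_diff power2_eq_square algebra_simps)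
      also have "2^k * (1/2)^k = (1 :: real)" by (simp flip: power_mult_distrib)
      finally show ?thesis by simp
    qed
    ultimately have "summable (\<lambda>k. d k x)" by (rule summable_comparison_test'[where N = 0])
    then have "convergent (\<lambda>n. \<Sum>k<n. d k x)" by (simp add: summable_iff_convergent)
    moreover have "(\<Sum>k<n. d k x) = F (r n) x - F (r 0) x" for n
      unfolding d_def by (rule sum_lessThan_telescope)
    ultimately have "convergent (\<lambda>n. F (r n) x - F (r 0) x)" by simp
    then have "convergent (\<lambda>n. F (r n) x - F (r 0) x + F (r 0) x)"
      by (intro convergent_add convergent_const)
    then show ?case by (simp add: convergent_LIMSEQ_iff)
  qed
  define f where "f x = lim (\<lambda>k. F (r k) x)" for x
  have fm [measurable]: "f \<in> borel_measurable M" unfolding f_def by measurable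
  have close: "integrable M (\<lambda>x. (F n x - f x)\<^sup>2) \<and> (\<integral>x. (F n x - f x)\<^sup>2 \<partial>M) \<le> \<epsilon>"
    if \<epsilon>: "0 < \<epsilon>" and n: "\<And>m. n \<le> m \<Longrightarrow> (\<integral>x. (F n x - F m x)\<^sup>2 \<partial>M) < \<epsilon>" for n \<epsilon>
  proof -
    have "(\<integral>\<^sup>+x. ennreal ((F n x - f x)\<^sup>2) \<partial>M) = (\<integral>\<^sup>+x. liminf (\<lambda>k. ennreal ((F n x - F (r k) x)\<^sup>2)) \<partial>M)"
    proof (rule nn_integral_cong_AE)
      show "AE x in M. ennreal ((F n x - f x)\<^sup>2) = liminf (\<lambda>k. ennreal ((F n x - F (r k) x)\<^sup>2))"
        using conv
      proof eventually_elim
        case (elim x)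
        then have "(\<lambda>k. ennreal ((F n x - F (r k) x)\<^sup>2)) \<longlonglongrightarrow> ennreal ((F n x - f x)\<^sup>2)"
          unfolding f_def by (intro tendsto_intros)
        then show ?case by (intro lim_imp_Liminf[symmetric]) auto
      qed
    qed
    also have "\<dots> \<le> liminf (\<lambda>k. \<integral>\<^sup>+x. ennreal ((F n x - F (r k) x)\<^sup>2) \<partial>M)"
      by (rule nn_integral_liminf) measurable
    also have "\<dots> \<le> ennreal \<epsilon>"
    proof (rule Liminf_le)
      show "\<forall>\<^sub>F k in sequentially. (\<integral>\<^sup>+x. ennreal ((F n x - F (r k) x)\<^sup>2) \<partial>M) \<le> ennreal \<epsilon>"
        using eventually_ge_at_top[of n]
      proof eventually_elim
        case (elim k)
        have "(\<integral>\<^sup>+x. ennreal ((F n x - F (r k) x)\<^sup>2) \<partial>M) = ennreal (\<integral>x. (F n x - F (r k) x)\<^sup>2 \<partial>M)"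
          using Fi by (intro nn_integral_eq_integral) auto
        then show ?case using n[of "r k"] elim r(3)[of k] by (simp add: ennreal_leI less_imp_le)
      qed
    qed simp
    finally have le: "(\<integral>\<^sup>+x. ennreal ((F n x - f x)\<^sup>2) \<partial>M) \<le> ennreal \<epsilon>" .
    then have "integrable M (\<lambda>x. (F n x - f x)\<^sup>2)"
      by (intro integrableI_bounded) (auto intro: order.strict_trans1)
    moreover from this have "ennreal (\<integral>x. (F n x - f x)\<^sup>2 \<partial>M) \<le> ennreal \<epsilon>"
      using le by (subst (asm) nn_integral_eq_integral) auto
    ultimately show ?thesis using \<epsilon> by simp
  qed
  have lim: "\<exists>N. \<forall>n\<ge>N. integrable M (\<lambda>x. (F n x - f x)\<^sup>2) \<and> (\<integral>x. (F n x - f x)\<^sup>2 \<partial>M) \<le> \<epsilon>"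
    if "0 < \<epsilon>" for \<epsilon>
  proof -
    obtain N where "\<forall>m\<ge>N. \<forall>n\<ge>N. (\<integral>x. (F m x - F n x)\<^sup>2 \<partial>M) < \<epsilon>"
      using cauchy \<open>0 < \<epsilon>\<close> by blast
    then show ?thesis
      using close[OF that] by (intro exI[of _ N] allI impI close that) auto
  qed
  obtain n where "integrable M (\<lambda>x. (F n x - f x)\<^sup>2)" using lim[of 1] by auto
  then have "square_integrable M (\<lambda>x. F n x - f x)" by (simp add: square_integrable_def)
  from square_integrable_diff[OF F[of n] this] have "square_integrable M f" by simp
  moreover have "(\<lambda>n. \<integral>x. (F n x - f x)\<^sup>2 \<partial>M) \<longlonglongrightarrow> 0"
  proof (rule LIMSEQ_I)
    fix \<epsilon> :: real assume "0 < \<epsilon>"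
    then obtain N where "\<forall>n\<ge>N. (\<integral>x. (F n x - f x)\<^sup>2 \<partial>M) \<le> \<epsilon> / 2" using lim[of "\<epsilon> / 2"] by auto
    then show "\<exists>N. \<forall>n\<ge>N. norm ((\<integral>x. (F n x - f x)\<^sup>2 \<partial>M) - 0) < \<epsilon>"
      using \<open>0 < \<epsilon>\<close> by (intro exI[of _ N]) (force intro: le_less_trans)
  qed
  ultimately show ?thesis by blast
qed

lemma L2_iff: "f \<in> L2 G \<longleftrightarrow> (\<forall>e. square_integrable (edge_measure G e) (f e))"
  by (simp add: L2_def square_integrable_def)

lemma L2_inner_eq: "L2_inner G f g = (\<Sum>e\<in>UNIV. \<integral>x. f e x * g e x \<partial>edge_measure G e)"
  by (simp add: L2_inner_def graph_integral_def)

lemma L2_mult_integrable: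
  "f \<in> L2 G \<Longrightarrow> g \<in> L2 G \<Longrightarrow> integrable (edge_measure G e) (\<lambda>x. f e x * g e x)"
  by (simp add: L2_iff square_integrable_mult)

lemma semi_inner_space_L2:
  fixes G :: "('v, 'e::finite) metric_graph"
  shows "semi_inner_space (L2 G) (L2_inner G)"
proof
  show "subspace (L2 G)"
    unfolding subspace_def L2_iff plus_fun_def scaleR_fun_def zero_fun_def real_scaleR_def
    by (auto simp: L2_iff square_integrable_def[of _ "\<lambda>x. 0"]
        intro: square_integrable_add square_integrable_cmult)
  show "L2_inner G x y = L2_inner G y x" for x y
    by (simp add: L2_inner_eq mult.commute)
  show "L2_inner G (x + y) z = L2_inner G x z + L2_inner G y z"
    if "x \<in> L2 G" "y \<in> L2 G" "z \<in> L2 G" for x y z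
    using that by (simp add: L2_inner_eq distrib_right L2_mult_integrable sum.distrib)
  show "L2_inner G (c *\<^sub>R x) y = c * L2_inner G x y" for c x y
    by (simp add: L2_inner_eq mult.assoc sum_distrib_left)
  show "0 \<le> L2_inner G x x" for x
    by (auto simp: L2_inner_eq intro!: sum_nonneg)
qed

lemma edge_integral_le_L2_inner:
  "(\<integral>x. f e x * f e x \<partial>edge_measure G e) \<le> L2_inner G f (f :: 'e::finite graph_fun)"
  unfolding L2_inner_eq by (rule member_le_sum) auto

lemma complete_semi_inner_space_L2:
  fixes G :: "('v, 'e::finite) metric_graph"
  shows "complete_semi_inner_space (L2 G) (L2_inner G)"
proof -
  interpret semi_inner_space "L2 G" "L2_inner G" by (rule semi_inner_space_L2)
  show ?thesis
  proof
    fix X :: "nat \<Rightarrow> 'e graph_fun"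
    assume X: "\<And>n. X n \<in> L2 G" and cauchy: "is_cauchy X"
    have "\<exists>f. square_integrable (edge_measure G e) f \<and>
        (\<lambda>n. \<integral>x. (X n e x - f x)\<^sup>2 \<partial>edge_measure G e) \<longlonglongrightarrow> 0" for e
    proof (rule square_integrable_complete)
      show "square_integrable (edge_measure G e) (X n e)" for n using X by (simp add: L2_iff)
      fix \<epsilon> :: real assume "0 < \<epsilon>"
      then obtain N where N: "\<forall>m\<ge>N. \<forall>n\<ge>N. L2_inner G (X m - X n) (X m - X n) < \<epsilon>"
        using cauchy unfolding is_cauchy_def by blast
      have "(\<integral>x. (X m e x - X n e x)\<^sup>2 \<partial>edge_measure G e) \<le> L2_inner G (X m - X n) (X m - X n)" for m n
        using edge_integral_le_L2_inner[where f = "X m - X n" and e = e and G = G]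
        by (simp add: power2_eq_square)
      then show "\<exists>N. \<forall>m\<ge>N. \<forall>n\<ge>N. (\<integral>x. (X m e x - X n e x)\<^sup>2 \<partial>edge_measure G e) < \<epsilon>"
        using N by (meson le_less_trans)
    qed
    then have "\<exists>f. \<forall>e. square_integrable (edge_measure G e) (f e) \<and>
        (\<lambda>n. \<integral>x. (X n e x - f e x)\<^sup>2 \<partial>edge_measure G e) \<longlonglongrightarrow> 0"
      by (intro choice allI)
    then obtain f where f: "\<And>e. square_integrable (edge_measure G e) (f e)"
      "\<And>e. (\<lambda>n. \<integral>x. (X n e x - f e x)\<^sup>2 \<partial>edge_measure G e) \<longlonglongrightarrow> 0"
      by blast
    have "converges X f"
      unfolding converges_def
      using tendsto_sum[of UNIV, OF f(2)] by (simp add: L2_inner_eq power2_eq_square)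
    then show "\<exists>x\<in>L2 G. converges X x" using f(1) by (auto simp: L2_iff)
  qed
qed

text \<open>Bridge to the abstract theory: a norm with a square root and sums taken pointwise on one
  side, squared distances and sums in the function space on the other.\<close>

lemma L2_sums_iff:
  assumes "\<And>n. h n \<in> L2 G" "f \<in> L2 G"
  shows "L2_sums G h f \<longleftrightarrow>
    semi_inner_space.converges (L2_inner G) (\<lambda>N. \<Sum>n<N. h n) (f :: 'e::finite graph_fun)"
proof -
  interpret semi_inner_space "L2 G" "L2_inner G" by (rule semi_inner_space_L2)
  have eq: "(\<lambda>e x. f e x - (\<Sum>n<N. h n e x)) = f - (\<Sum>n<N. h n)" for N
    by (simp add: fun_eq_iff sum_fun_apply)
  have comm: "L2_inner G (f - (\<Sum>n<N. h n)) (f - (\<Sum>n<N. h n))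
      = L2_inner G ((\<Sum>n<N. h n) - f) ((\<Sum>n<N. h n) - f)" for N
    using assms by (intro diff_sq_commute) auto
  show ?thesis
    unfolding L2_sums_def L2_norm_def eq comm converges_def
    using tendsto_real_sqrt[of _ 0] tendsto_power[of _ 0 _ 2] assms
    by (auto simp: nonneg dest: tendsto_power[of _ 0 _ 2])
qed

section \<open>Primitives of integrable functions\<close>

lemma continuous_square_integrable:
  fixes f :: "real \<Rightarrow> real"
  assumes "continuous_on {a..b} f"
  shows "square_integrable (lebesgue_on {a..b}) f"
  unfolding square_integrable_def
  using continuous_imp_integrable_real[OF assms] assms
  by (auto intro!: continuous_imp_integrable_real continuous_intros)

lemma square_integrable_imp_integrable:
  "square_integrable (lebesgue_on {a..b}) f \<Longrightarrow> integrable (lebesgue_on {a..b :: real}) f"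
  using square_integrable_mult[OF _ continuous_square_integrable[of a b "\<lambda>_. 1"], of f] by simp

lemma integrable_lebesgue_on_subinterval:
  fixes f :: "real \<Rightarrow> real"
  assumes "integrable (lebesgue_on {a..b}) f" "{c..d} \<subseteq> {a..b}"
  shows "integrable (lebesgue_on {c..d}) f"
  using integrable_subinterval assms by blast

lemma integral_indicator_lebesgue_on:
  fixes f :: "real \<Rightarrow> real"
  assumes "{c..d} \<subseteq> {a..b}"
  shows "(\<integral>t. indicator {c..d} t * f t \<partial>lebesgue_on {a..b}) = (\<integral>t. f t \<partial>lebesgue_on {c..d})"
proof -
  have eq: "indicator {a..b} t * (indicator {c..d} t * f t) = indicator {c..d} t * f t" for t :: real
    using assms by (auto simp: indicator_def)
  show ?thesis by (simp add: integral_restrict_space eq)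
qed

lemma integral_deriv_lebesgue_on:
  fixes w :: "real \<Rightarrow> real"
  assumes "a \<le> b" "continuous_on {a..b} w'"
    and "\<And>x. x \<in> {a..b} \<Longrightarrow> (w has_real_derivative w' x) (at x within {a..b})"
  shows "(\<integral>t. w' t \<partial>lebesgue_on {a..b}) = w b - w a"
proof -
  have "(w' has_integral (w b - w a)) {a..b}"
    using assms by (intro fundamental_theorem_of_calculus)
      (auto simp: has_real_derivative_iff_has_vector_derivative)
  then show ?thesis
    using continuous_imp_integrable_real[OF assms(2)]
    by (simp add: lebesgue_integral_eq_integral integral_unique)
qed

definition prim :: "(real \<Rightarrow> real) \<Rightarrow> real \<Rightarrow> real" where
  "prim g x = (\<integral>t. g t \<partial>lebesgue_on {0..x})"

lemma prim_0 [simp]: "prim g 0 = 0"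
proof -
  have "AE t in lebesgue. (0::real) \<noteq> t"
    using AE_lborel_singleton[of "0::real"] by (simp add: AE_completion_iff neq_commute)
  then have "AE t in lebesgue. indicator {0..0} t * g t = 0"
    by eventually_elim (auto simp: indicator_def)
  then show ?thesis
    by (simp add: prim_def integral_restrict_space integral_eq_zero_AE)
qed

lemma prim_continuous:
  "integrable (lebesgue_on {0..l}) g \<Longrightarrow> continuous_on {0..l} (prim g)"
  unfolding prim_def by (rule indefinite_integral_continuous_real)

lemma prim_add:
  assumes "integrable (lebesgue_on {0..l}) f" "integrable (lebesgue_on {0..l}) g" "x \<le> l"
  shows "prim (\<lambda>t. f t + g t) x = prim f x + prim g x"
  unfolding prim_def
  by (intro Bochner_Integration.integral_add)
    (rule integrable_lebesgue_on_subinterval[of 0 l], use assms in auto)+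

lemma prim_cmult: "prim (\<lambda>t. c * f t) x = c * prim f x"
  unfolding prim_def by simp

lemma prim_cong: "(\<And>t. 0 \<le> t \<Longrightarrow> t \<le> x \<Longrightarrow> f t = g t) \<Longrightarrow> prim f x = prim g x"
  unfolding prim_def by (intro Bochner_Integration.integral_cong) auto

lemma prim_has_derivative:
  assumes "continuous_on {0..l} g" "x \<in> {0..l}"
  shows "(prim g has_real_derivative g x) (at x within {0..l})"
proof -
  have d: "((\<lambda>x. integral {0..x} g) has_real_derivative g x) (at x within {0..l})"
    using assms integral_has_real_derivative by blast
  have eq: "integral {0..y} g = prim g y" if "y \<in> {0..l}" for y
    using integrable_lebesgue_on_subinterval[OF continuous_imp_integrable_real[OF assms(1)], of 0 y] that
    by (simp add: prim_def lebesgue_integral_eq_integral)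
  show ?thesis
    by (rule has_field_derivative_transform_within[OF d zero_less_one assms(2)]) (rule eq)
qed

text \<open>As \<open>g\<close> is merely integrable, \<open>prim g\<close> need not be differentiable; the identity is
  Fubini's theorem for \<open>g x * w' t\<close> on the triangle \<open>x \<le> t\<close>.\<close>

lemma integral_by_parts_prim:
  assumes l: "0 \<le> l" and g: "integrable (lebesgue_on {0..l}) g"
    and w'c: "continuous_on {0..l} w'"
    and w: "\<And>x. x \<in> {0..l} \<Longrightarrow> (w has_real_derivative w' x) (at x within {0..l})"
  shows "(\<integral>x. g x * w x \<partial>lebesgue_on {0..l})
    = prim g l * w l - (\<integral>x. prim g x * w' x \<partial>lebesgue_on {0..l})"
proof -
  define M where "M = lebesgue_on {0..l}"
  interpret M: finite_measure M unfolding M_def by (rule finite_measure_lebesgue_on) simp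
  interpret MM: pair_sigma_finite M M by unfold_locales
  have space: "space M = {0..l}" by (simp add: M_def)
  have g' [measurable]: "g \<in> borel_measurable M" "integrable M g" using g by (auto simp: M_def)
  have w'i [measurable]: "w' \<in> borel_measurable M" "integrable M w'"
    using continuous_imp_integrable_real[OF w'c] by (auto simp: M_def)
  have id_meas [measurable]: "(\<lambda>x. x) \<in> borel_measurable M"
    using continuous_imp_integrable_real[OF continuous_on_id, of 0 l] by (auto simp: M_def)
  have prod: "integrable (M \<Otimes>\<^sub>M M) (\<lambda>(x, t). g x * w' t)"
  proof (rule MM.Fubini_integrable)
    show "integrable M (\<lambda>x. \<integral>y. norm (case (x, y) of (x, t) \<Rightarrow> g x * w' t) \<partial>M)"
      using g' by (simp add: abs_mult)
    show "AE x in M. integrable M (\<lambda>y. case (x, y) of (x, t) \<Rightarrow> g x * w' t)"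
      using w'i by simp
  qed measurable
  have int: "integrable (M \<Otimes>\<^sub>M M) (\<lambda>(x, t). (if x \<le> t then g x * w' t else 0))"
    by (rule Bochner_Integration.integrable_bound[OF prod]) (auto simp: split_beta)
  have "(\<integral>t. (\<integral>x. (if x \<le> t then g x * w' t else 0) \<partial>M) \<partial>M)
      = (\<integral>x. (\<integral>t. (if x \<le> t then g x * w' t else 0) \<partial>M) \<partial>M)"
    by (rule MM.Fubini_integral[OF int])
  also have "\<dots> = (\<integral>x. g x * w l - g x * w x \<partial>M)"
  proof (rule Bochner_Integration.integral_cong[OF refl])
    fix x assume "x \<in> space M"
    then have x: "0 \<le> x" "x \<le> l" by (auto simp: space)
    have "(\<integral>t. (if x \<le> t then g x * w' t else 0) \<partial>M) = (\<integral>t. g x * (indicator {x..l} t * w' t) \<partial>M)"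
      by (intro Bochner_Integration.integral_cong) (auto simp: space indicator_def)
    also have "\<dots> = g x * (\<integral>t. w' t \<partial>lebesgue_on {x..l})"
      unfolding M_def using x by (subst integral_mult_right_zero, subst integral_indicator_lebesgue_on) auto
    also have "(\<integral>t. w' t \<partial>lebesgue_on {x..l}) = w l - w x"
    proof (rule integral_deriv_lebesgue_on)
      show "continuous_on {x..l} w'" using x by (intro continuous_on_subset[OF w'c]) auto
      show "(w has_real_derivative w' y) (at y within {x..l})" if "y \<in> {x..l}" for y
        using x that by (intro DERIV_subset[OF w]) auto
    qed (use x in simp)
    finally show "(\<integral>t. (if x \<le> t then g x * w' t else 0) \<partial>M) = g x * w l - g x * w x"
      by (simp add: right_diff_distrib)
  qed
  also have "\<dots> = (\<integral>x. g x * w l \<partial>M) - (\<integral>x. g x * w x \<partial>M)"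
  proof (rule Bochner_Integration.integral_diff)
    have wc: "continuous_on {0..l} w" by (rule DERIV_continuous_on[OF w])
    then have "bounded (w ` {0..l})" by (intro compact_imp_bounded compact_continuous_image) auto
    then obtain C where C: "\<forall>x\<in>{0..l}. \<bar>w x\<bar> \<le> C" by (auto simp: bounded_iff)
    have [measurable]: "w \<in> borel_measurable M"
      using continuous_imp_integrable_real[OF wc] by (auto simp: M_def)
    have "integrable M (\<lambda>x. g x * C)" using g' by simp
    then show "integrable M (\<lambda>x. g x * w x)"
    proof (rule Bochner_Integration.integrable_bound)
      show "AE x in M. norm (g x * w x) \<le> norm (g x * C)"
      proof (rule AE_I2)
        fix x assume "x \<in> space M"
        then have "\<bar>w x\<bar> \<le> \<bar>C\<bar>" using C by (force simp: space)
        then show "norm (g x * w x) \<le> norm (g x * C)" by (simp add: abs_mult mult_left_mono)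
      qed
    qed measurable
  qed (use g' in simp)
  also have "(\<integral>x. g x * w l \<partial>M) = prim g l * w l" by (simp add: M_def prim_def)
  also have "(\<integral>t. (\<integral>x. (if x \<le> t then g x * w' t else 0) \<partial>M) \<partial>M) = (\<integral>t. prim g t * w' t \<partial>M)"
  proof (rule Bochner_Integration.integral_cong[OF refl])
    fix t assume "t \<in> space M"
    then have t: "0 \<le> t" "t \<le> l" by (auto simp: space)
    have "(\<integral>x. (if x \<le> t then g x * w' t else 0) \<partial>M) = (\<integral>x. (indicator {0..t} x * g x) * w' t \<partial>M)"
      by (intro Bochner_Integration.integral_cong) (auto simp: space indicator_def)
    also have "\<dots> = prim g t * w' t"
      unfolding M_def prim_def using t by (subst integral_mult_left_zero, subst integral_indicator_lebesgue_on) auto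
    finally show "(\<integral>x. (if x \<le> t then g x * w' t else 0) \<partial>M) = prim g t * w' t" .
  qed
  finally show ?thesis by (simp add: M_def)
qed

text \<open>Since \<open>ennreal\<close> sends negative numbers to 0, the two densities are the
  positive and the negative part of \<open>f\<close>. The hypothesis says that these finite measures
  agree on all rays, hence they coincide, and uniqueness of densities makes both parts equal almost
  everywhere.\<close>

lemma AE_eq_0_if_integral_rays_eq_0:
  fixes f :: "real \<Rightarrow> real"
  assumes f [measurable]: "integrable lborel f"
    and 0: "\<And>x. (\<integral>t. indicator {x<..} t * f t \<partial>lborel) = 0"
  shows "AE x in lborel. f x = 0"
proof -
  have [measurable]: "f \<in> borel_measurable borel" using f by auto
  have fin: "(\<integral>\<^sup>+t. ennreal (h t) \<partial>lborel) < top" if "integrable lborel h" for h :: "real \<Rightarrow> real"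
    using integrableD(2)[OF that] by (simp add: less_top)
  have int: "integrable lborel (\<lambda>t. indicator {x<..} t * f t)" for x
    using integrable_mult_indicator[OF _ f, of "{x<..}"] by simp
  have em: "emeasure (density lborel (\<lambda>t. ennreal (c * f t))) {x<..}
      = (\<integral>\<^sup>+t. ennreal (c * (indicator {x<..} t * f t)) \<partial>lborel)" for x c
    by (subst emeasure_density) (auto intro!: nn_integral_cong simp: indicator_def)
  have "density lborel (\<lambda>t. ennreal (1 * f t)) = density lborel (\<lambda>t. ennreal (- 1 * f t))"
  proof (rule measure_eqI_lessThan)
    fix x
    show "emeasure (density lborel (\<lambda>t. ennreal (1 * f t))) {x<..} < \<infinity>"
      unfolding em infinity_ennreal_def using int by (intro fin) simp
    have eq: "enn2real (\<integral>\<^sup>+t. ennreal (1 * (indicator {x<..} t * f t)) \<partial>lborel)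
        = enn2real (\<integral>\<^sup>+t. ennreal (- 1 * (indicator {x<..} t * f t)) \<partial>lborel)"
      using real_lebesgue_integral_def[OF int, of x] 0[of x] by simp
    have "ennreal (enn2real (\<integral>\<^sup>+t. ennreal (c * (indicator {x<..} t * f t)) \<partial>lborel))
        = (\<integral>\<^sup>+t. ennreal (c * (indicator {x<..} t * f t)) \<partial>lborel)" for c
      using int by (intro ennreal_enn2real fin) simp
    from this[of 1] this[of "- 1"] show "emeasure (density lborel (\<lambda>t. ennreal (1 * f t))) {x<..}
        = emeasure (density lborel (\<lambda>t. ennreal (- 1 * f t))) {x<..}"
      unfolding em eq by (rule trans[OF sym])
  qed auto
  then have "AE t in lborel. ennreal (1 * f t) = ennreal (- 1 * f t)"
    by (intro sigma_finite_measure.density_unique[OF sigma_finite_lborel]) auto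
  then show ?thesis
  proof eventually_elim
    case (elim t)
    then show ?case by (cases "0 \<le> f t") (auto simp: ennreal_neg ennreal_eq_0_iff)
  qed
qed

text \<open>The ray criterion lives on \<open>lborel\<close>, so \<open>g\<close> is extended by
  zero and replaced by a Borel function that agrees with it almost everywhere. Its integral over a
  ray is a difference of two values of \<open>prim g\<close>.\<close>

lemma AE_eq_0_if_prim_eq_0:
  assumes g: "integrable (lebesgue_on {0..l}) g" and 0: "\<And>x. x \<in> {0..l} \<Longrightarrow> prim g x = 0"
    and l: "0 \<le> l"
  shows "AE x in lebesgue_on {0..l}. g x = 0"
proof -
  define h where "h t = indicator {0..l} t * g t" for t
  have h: "integrable lebesgue h"
    using g integrable_restrict_space[of "{0..l}" lebesgue g] by (simp add: h_def[abs_def])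
  then obtain f where f [measurable]: "f \<in> borel_measurable lborel" and fh: "AE x in lborel. h x = f x"
    using completion_ex_borel_measurable_real[of h lborel] by auto
  have fh': "AE x in lebesgue. h x = f x" using fh by (simp add: AE_completion_iff)
  have f_leb: "f \<in> borel_measurable lebesgue" using measurable_completion f by blast
  have "integrable lebesgue f"
    using h fh' f_leb integrable_cong_AE by blast
  then have fi: "integrable lborel f" by (simp add: integrable_completion)
  have "AE x in lborel. f x = 0"
  proof (rule AE_eq_0_if_integral_rays_eq_0[OF fi])
    fix x :: real
    \<comment> \<open>The starting point of the ray, clamped to the interval that carries the
      function.\<close>
    define c where "c = max 0 (min l x)"
    have c: "0 \<le> c" "c \<le> l" using l by (auto simp: c_def)
    have "(\<integral>t. indicator {x<..} t * f t \<partial>lborel) = (\<integral>t. indicator {x<..} t * f t \<partial>lebesgue)"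
      by (intro integral_completion[symmetric]) measurable
    also have "\<dots> = (\<integral>t. indicator {x<..} t * h t \<partial>lebesgue)"
    proof (rule integral_cong_AE)
      show "AE t in lebesgue. indicator {x<..} t * f t = indicator {x<..} t * h t"
        using fh' by eventually_elim auto
    qed (use f_leb h in \<open>auto intro!: borel_measurable_times borel_measurable_indicator\<close>)
    also have "\<dots> = (\<integral>t. h t - indicator {..x} t * h t \<partial>lebesgue)"
      by (intro Bochner_Integration.integral_cong) (auto simp: indicator_def)
    also have "\<dots> = (\<integral>t. h t \<partial>lebesgue) - (\<integral>t. indicator {..x} t * h t \<partial>lebesgue)"
      using h integrable_mult_indicator[OF _ h, of "{..x}"] by (intro Bochner_Integration.integral_diff) auto
    also have "(\<integral>t. h t \<partial>lebesgue) = prim g l"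
      by (simp add: h_def prim_def integral_restrict_space)
    also have "\<dots> = 0" using 0 l by simp
    also have "(\<integral>t. indicator {..x} t * h t \<partial>lebesgue) = 0"
    proof (cases "0 \<le> x")
      case True
      have "(\<integral>t. indicator {..x} t * h t \<partial>lebesgue) = (\<integral>t. indicator {0..c} t * g t \<partial>lebesgue)"
        using True l by (intro Bochner_Integration.integral_cong) (auto simp: indicator_def h_def c_def)
      also have "\<dots> = prim g c"
        by (simp add: prim_def integral_restrict_space)
      finally show ?thesis using 0 c by simp
    next
      case False
      then have "(\<lambda>t. indicator {..x} t * h t) = (\<lambda>t. 0)" by (auto simp: indicator_def h_def fun_eq_iff)
      then show ?thesis by simp
    qed
    finally show "(\<integral>t. indicator {x<..} t * f t \<partial>lborel) = 0" by simp
  qed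
  then have "AE x in lebesgue. f x = 0" by (simp add: AE_completion_iff)
  with fh' have "AE x in lebesgue. h x = 0" by eventually_elim simp
  then show ?thesis
    by (subst AE_restrict_space_iff) (auto simp: h_def elim!: eventually_mono)
qed

section \<open>Green's identity and the Green operator\<close>

lemma H2_derivs_regular:
  assumes "H2_derivs l f f' f''"
  shows "continuous_on {0..l} f" "square_integrable (lebesgue_on {0..l}) f''"
    "integrable (lebesgue_on {0..l}) f''"
    "\<And>x. x \<in> {0..l} \<Longrightarrow> f' x = f' 0 + prim f'' x" "continuous_on {0..l} f'"
proof -
  show "continuous_on {0..l} f"
  proof (rule DERIV_continuous_on)
    show "(f has_real_derivative f' x) (at x within {0..l})" if "x \<in> {0..l}" for x
      using assms that unfolding H2_derivs_def by blast
  qed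
  show sq: "square_integrable (lebesgue_on {0..l}) f''"
    using assms by (auto simp: H2_derivs_def square_integrable_def)
  then show int: "integrable (lebesgue_on {0..l}) f''" by (rule square_integrable_imp_integrable)
  show eq: "f' x = f' 0 + prim f'' x" if "x \<in> {0..l}" for x
    using assms that unfolding H2_derivs_def prim_def by (elim conjE bspec)
  have "continuous_on {0..l} (\<lambda>x. f' 0 + prim f'' x)"
    using int by (intro continuous_intros prim_continuous)
  then show "continuous_on {0..l} f'"
    by (rule continuous_on_eq) (rule eq[symmetric])
qed

lemma green_identity_interval:
  assumes u: "H2_derivs l u u' u''" and w: "H2_derivs l w w' w''" and l: "0 \<le> l"
  shows "(\<integral>x. u'' x * w x \<partial>lebesgue_on {0..l})
    = u' l * w l - u' 0 * w 0 - (\<integral>x. u' x * w' x \<partial>lebesgue_on {0..l})"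
proof -
  note ur = H2_derivs_regular[OF u] and wr = H2_derivs_regular[OF w]
  have w': "(w has_real_derivative w' x) (at x within {0..l})" if "x \<in> {0..l}" for x
    using w that unfolding H2_derivs_def by blast
  have "(\<integral>x. u'' x * w x \<partial>lebesgue_on {0..l})
      = prim u'' l * w l - (\<integral>x. prim u'' x * w' x \<partial>lebesgue_on {0..l})"
    by (rule integral_by_parts_prim[OF l ur(3) wr(5) w'])
  also have "(\<integral>x. prim u'' x * w' x \<partial>lebesgue_on {0..l})
      = (\<integral>x. u' x * w' x - u' 0 * w' x \<partial>lebesgue_on {0..l})"
  proof (rule Bochner_Integration.integral_cong[OF refl])
    fix x assume "x \<in> space (lebesgue_on {0..l})"
    then have "u' x = u' 0 + prim u'' x" by (intro ur(4)) simp
    then have "prim u'' x = u' x - u' 0" by linarith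
    then show "prim u'' x * w' x = u' x * w' x - u' 0 * w' x" by (simp only: left_diff_distrib)
  qed
  also have "\<dots> = (\<integral>x. u' x * w' x \<partial>lebesgue_on {0..l}) - (\<integral>x. u' 0 * w' x \<partial>lebesgue_on {0..l})"
    using ur(5) wr(5)
    by (intro Bochner_Integration.integral_diff continuous_imp_integrable_real continuous_intros)
  also have "(\<integral>x. u' 0 * w' x \<partial>lebesgue_on {0..l}) = u' 0 * (w l - w 0)"
    using integral_deriv_lebesgue_on[OF l wr(5) w'] by simp
  also have "prim u'' l = u' l - u' 0"
  proof -
    have "u' l = u' 0 + prim u'' l" by (intro ur(4)) (use l in simp)
    then show ?thesis by linarith
  qed
  finally show ?thesis by (simp add: algebra_simps)
qed

lemma sum_over_fibres:
  fixes t :: "'e::finite \<Rightarrow> 'v::finite" and h :: "'v \<Rightarrow> real"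
  shows "(\<Sum>v\<in>UNIV. h v * (\<Sum>e | t e = v. a e)) = (\<Sum>e\<in>UNIV. h (t e) * a e)"
proof -
  have "(\<Sum>v\<in>UNIV. h v * (\<Sum>e | t e = v. a e)) = (\<Sum>v\<in>UNIV. \<Sum>e\<in>{e \<in> UNIV. t e = v}. h (t e) * a e)"
    by (auto simp: sum_distrib_left intro!: sum.cong)
  also have "\<dots> = (\<Sum>e\<in>UNIV. h (t e) * a e)" by (rule sum.group) auto
  finally show ?thesis .
qed

text \<open>Grouping the edge ends by vertex gives each vertex the term \<open>h v\<close> times its
  Kirchhoff sum, and one of these two factors is zero. This serves both Green's identity and the
  discrete energy argument.\<close>

lemma kirchhoff_pairing:
  fixes G :: "('v::finite, 'e::finite) metric_graph"
  assumes "kirchhoff G f'" "\<And>v. v \<in> dirichlet G \<Longrightarrow> h v = (0::real)"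
  shows "(\<Sum>e\<in>UNIV. h (head G e) * f' e (len G e) - h (tail G e) * f' e 0) = 0"
proof -
  have "(\<Sum>e\<in>UNIV. h (head G e) * f' e (len G e) - h (tail G e) * f' e 0)
      = (\<Sum>v\<in>UNIV. h v * ((\<Sum>e | head G e = v. f' e (len G e)) + (\<Sum>e | tail G e = v. - f' e 0)))"
    by (simp add: distrib_left right_diff_distrib sum.distrib sum_over_fibres sum_subtractf sum_negf)
  also have "\<dots> = (\<Sum>v\<in>(UNIV :: 'v set). 0)"
    using assms unfolding kirchhoff_def by (intro sum.cong) auto
  finally show ?thesis by simp
qed

lemma green_identity:
  fixes G :: "('v::finite, 'e::finite) metric_graph"
  assumes u: "\<And>e. H2_derivs (len G e) (u e) (u' e) (u'' e)" and w: "\<And>e. H2_derivs (len G e) (w e) (w' e) (w'' e)"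
    and len: "\<And>e. 0 \<le> len G e" and K: "kirchhoff G u'" and c: "continuous_at_vertices G w"
  shows "(\<Sum>e\<in>UNIV. \<integral>x. u'' e x * w e x \<partial>edge_measure G e)
    = - (\<Sum>e\<in>UNIV. \<integral>x. u' e x * w' e x \<partial>edge_measure G e)"
proof -
  obtain h where h: "\<And>e. w e 0 = h (tail G e)" "\<And>e. w e (len G e) = h (head G e)"
    "\<And>v. v \<in> dirichlet G \<Longrightarrow> h v = 0"
    using c unfolding continuous_at_vertices_def by blast
  have "(\<Sum>e\<in>UNIV. \<integral>x. u'' e x * w e x \<partial>edge_measure G e)
      = (\<Sum>e\<in>UNIV. (h (head G e) * u' e (len G e) - h (tail G e) * u' e 0)
          - (\<integral>x. u' e x * w' e x \<partial>edge_measure G e))"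
    by (intro sum.cong) (auto simp: green_identity_interval[OF u w len] h)
  then show ?thesis using kirchhoff_pairing[OF K h(3)] by (simp add: sum_subtractf)
qed

lemma neg_laplacian_mem_L2: "neg_laplacian G u f \<Longrightarrow> u \<in> L2 G"
  unfolding neg_laplacian_def L2_iff
  using H2_derivs_regular(1) continuous_square_integrable by blast

text \<open>Both sides equal the integral of \<open>u' * w'\<close> over the graph. For the Green
  operator this yields symmetry and positivity, for eigenfunctions it yields orthogonality between
  different eigenvalues.\<close>

lemma neg_laplacian_green:
  fixes G :: "('v::finite, 'e::finite) metric_graph"
  assumes u: "neg_laplacian G u f" "f \<in> L2 G" and w: "neg_laplacian G w g" "g \<in> L2 G"
    and len: "\<And>e. 0 \<le> len G e"
  shows "L2_inner G f w = L2_inner G g u" "0 \<le> L2_inner G f u"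
proof -
  obtain u' u'' where u': "\<And>e. H2_derivs (len G e) (u e) (u' e) (u'' e)" "continuous_at_vertices G u"
    "kirchhoff G u'" "\<And>e. AE x in edge_measure G e. f e x = - u'' e x"
    using u unfolding neg_laplacian_def by blast
  obtain w' w'' where w': "\<And>e. H2_derivs (len G e) (w e) (w' e) (w'' e)" "continuous_at_vertices G w"
    "kirchhoff G w'" "\<And>e. AE x in edge_measure G e. g e x = - w'' e x"
    using w unfolding neg_laplacian_def by blast
  have eq: "L2_inner G f1 v = - (\<Sum>e\<in>UNIV. \<integral>x. f2 e x * v e x \<partial>edge_measure G e)"
    if "\<And>e. AE x in edge_measure G e. f1 e x = - f2 e x" "f1 \<in> L2 G" "v \<in> L2 G"
      "\<And>e. f2 e \<in> borel_measurable (edge_measure G e)" for f1 f2 v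
  proof -
    have "(\<integral>x. f1 e x * v e x \<partial>edge_measure G e) = (\<integral>x. - (f2 e x * v e x) \<partial>edge_measure G e)" for e
      using that(1)[of e] that(2-4)
      by (intro integral_cong_AE) (auto simp: L2_def intro!: borel_measurable_times elim!: eventually_mono)
    then show ?thesis by (simp add: L2_inner_eq sum_negf)
  qed
  have meas: "u'' e \<in> borel_measurable (edge_measure G e)" "w'' e \<in> borel_measurable (edge_measure G e)" for e
    using u'(1)[of e] w'(1)[of e] by (auto simp: H2_derivs_def)
  note L2 = neg_laplacian_mem_L2[OF u(1)] neg_laplacian_mem_L2[OF w(1)]
  have "L2_inner G f w = (\<Sum>e\<in>UNIV. \<integral>x. u' e x * w' e x \<partial>edge_measure G e)"
    using eq[OF u'(4) u(2) L2(2) meas(1)] green_identity[OF u'(1) w'(1) len u'(3) w'(2)] by simp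
  moreover have "L2_inner G g u = (\<Sum>e\<in>UNIV. \<integral>x. w' e x * u' e x \<partial>edge_measure G e)"
    using eq[OF w'(4) w(2) L2(1) meas(2)] green_identity[OF w'(1) u'(1) len w'(3) u'(2)] by simp
  ultimately show "L2_inner G f w = L2_inner G g u" by (simp add: mult.commute)
  have "L2_inner G f u = (\<Sum>e\<in>UNIV. \<integral>x. u' e x * u' e x \<partial>edge_measure G e)"
    using eq[OF u'(4) u(2) L2(1) meas(1)] green_identity[OF u'(1) u'(1) len u'(3) u'(2)] by simp
  also have "0 \<le> \<dots>" by (intro sum_nonneg) simp
  finally show "0 \<le> L2_inner G f u" .
qed

text \<open>
  On the edge \<open>e\<close> every solution of \<open>-u'' = g\<close> has the form
  \<open>h (tail G e) + s e * x - prim (prim (g e)) x\<close>, where \<open>h\<close> are the vertex values and \<open>s e\<close> is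
  determined by \<open>h (head G e)\<close>. The Kirchhoff conditions then become
  \<open>vertex_operator G h = vertex_load G g\<close>.
\<close>

definition vertex_operator :: "('v::finite, 'e::finite) metric_graph \<Rightarrow> real ^ 'v \<Rightarrow> real ^ 'v" where
  "vertex_operator G h = (\<chi> v. if v \<in> dirichlet G then h $ v else
     (\<Sum>e | head G e = v. (h $ head G e - h $ tail G e) / len G e)
     - (\<Sum>e | tail G e = v. (h $ head G e - h $ tail G e) / len G e))"

text \<open>Minus the Kirchhoff sum of the particular solution
  \<open>x * prim (prim (g e)) l / l - prim (prim (g e)) x\<close>, where
  \<open>l = len G e\<close>, which vanishes at both ends of the edge. A Dirichlet row of
  \<open>vertex_operator\<close> is the identity, so the entry 0 prescribes the vertex value
  there.\<close>

definition vertex_load :: "('v::finite, 'e::finite) metric_graph \<Rightarrow> 'e graph_fun \<Rightarrow> real ^ 'v" where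
  "vertex_load G g = (\<chi> v. if v \<in> dirichlet G then 0 else
     (\<Sum>e | head G e = v. prim (g e) (len G e) - prim (prim (g e)) (len G e) / len G e)
     + (\<Sum>e | tail G e = v. prim (prim (g e)) (len G e) / len G e))"

definition vertex_values :: "('v::finite, 'e::finite) metric_graph \<Rightarrow> 'e graph_fun \<Rightarrow> real ^ 'v" where
  "vertex_values G g = inv (vertex_operator G) (vertex_load G g)"

definition slope :: "('v::finite, 'e::finite) metric_graph \<Rightarrow> 'e graph_fun \<Rightarrow> 'e \<Rightarrow> real" where
  "slope G g e = (vertex_values G g $ head G e - vertex_values G g $ tail G e
     + prim (prim (g e)) (len G e)) / len G e"

text \<open>The function is cut off outside the edge so that \<open>green_op G\<close> is linear on the nose.\<close>

definition green_op :: "('v::finite, 'e::finite) metric_graph \<Rightarrow> 'e graph_fun \<Rightarrow> 'e graph_fun" where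
  "green_op G g e x = (if x \<in> {0..len G e}
     then vertex_values G g $ tail G e + slope G g e * x - prim (prim (g e)) x else 0)"

lemma linear_vertex_operator: "linear (vertex_operator G)"
  by (rule linearI)
    (auto simp: vertex_operator_def vec_eq_iff sum.distrib sum_subtractf add_divide_distrib diff_divide_distrib
      algebra_simps sum_distrib_left)

lemma prim_scale: "prim (c *\<^sub>R h) = c *\<^sub>R prim h"
  using prim_cmult[of c h] by (simp add: scaleR_fun_def fun_eq_iff)

locale dirichlet_graph =
  fixes G :: "('v::finite, 'e::finite) metric_graph"
  assumes len_pos: "0 < len G e"
    and connected: "graph_connected G"
    and dirichlet_nonempty: "dirichlet G \<noteq> {}"
begin

lemma len_nonneg: "0 \<le> len G e"
  using len_pos[of e] by simp

text \<open>Pairing \<open>vertex_operator G h\<close> with \<open>h\<close> gives the discrete Dirichlet energy of \<open>h\<close>.\<close>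

lemma inj_vertex_operator: "inj (vertex_operator G)"
proof -
  have "h = 0" if 0: "vertex_operator G h = 0" for h
  proof -
    define d where "d e = (h $ head G e - h $ tail G e) / len G e" for e
    have dir: "h $ v = 0" if "v \<in> dirichlet G" for v
      using 0 that by (auto simp: vertex_operator_def vec_eq_iff split: if_splits dest: spec[of _ v])
    \<comment> \<open>\<open>d\<close> is the derivative of the edgewise affine function with vertex
      values \<open>h\<close>; the rows at the other vertices are its Kirchhoff conditions.\<close>
    have "kirchhoff G (\<lambda>e x. d e)"
      using 0 by (auto simp: kirchhoff_def vertex_operator_def vec_eq_iff d_def sum_negf
          dest: spec split: if_splits)
    then have "(\<Sum>e\<in>UNIV. h $ head G e * d e - h $ tail G e * d e) = 0"
      using kirchhoff_pairing[of G "\<lambda>e x. d e" "\<lambda>v. h $ v"] dir by simp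
    moreover have "h $ head G e * d e - h $ tail G e * d e = (h $ head G e - h $ tail G e)\<^sup>2 / len G e" for e
      by (simp add: d_def power2_eq_square left_diff_distrib[symmetric] diff_divide_distrib[symmetric])
    ultimately have "(\<Sum>e\<in>UNIV. (h $ head G e - h $ tail G e)\<^sup>2 / len G e) = 0" by simp
    then have "\<forall>e\<in>UNIV. (h $ head G e - h $ tail G e)\<^sup>2 / len G e = 0"
      by (subst (asm) sum_nonneg_eq_0_iff) (auto simp: len_nonneg)
    then have edge: "h $ head G e = h $ tail G e" for e
      using len_pos[of e] by auto
    have "h $ v = h $ w"
      if "(v, w) \<in> (range (\<lambda>e. (tail G e, head G e)) \<union> range (\<lambda>e. (head G e, tail G e)))\<^sup>*" for v w
      using that by (induction rule: rtrancl_induct) (auto simp: edge)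
    then have const: "h $ v = h $ w" for v w
      using connected unfolding graph_connected_def by blast
    obtain v0 where "v0 \<in> dirichlet G" using dirichlet_nonempty by blast
    then show "h = 0" using const[of _ v0] dir by (simp add: vec_eq_iff)
  qed
  then show ?thesis
    using linear_injective_0[OF linear_vertex_operator] by blast
qed

lemma surj_vertex_operator: "surj (vertex_operator G)"
  using linear_inj_imp_surj[OF linear_vertex_operator inj_vertex_operator] .

lemma vertex_operator_values: "vertex_operator G (vertex_values G g) = vertex_load G g"
  unfolding vertex_values_def by (rule surj_f_inv_f[OF surj_vertex_operator])

lemma vertex_values_unique: "vertex_operator G h = vertex_load G g \<Longrightarrow> vertex_values G g = h"
  using inj_vertex_operator vertex_operator_values by (metis injD)

lemma integrable_edge: "g \<in> L2 G \<Longrightarrow> integrable (edge_measure G e) (g e)"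
  by (simp add: L2_iff square_integrable_imp_integrable)

lemma integrable_prim: "g \<in> L2 G \<Longrightarrow> integrable (edge_measure G e) (prim (g e))"
  by (intro continuous_imp_integrable_real prim_continuous integrable_edge)

lemma prim_plus:
  assumes "f \<in> L2 G" "g \<in> L2 G" "x \<le> len G e"
  shows "prim (f e + g e) x = prim (f e) x + prim (g e) x"
    "prim (prim (f e + g e)) x = prim (prim (f e)) x + prim (prim (g e)) x"
proof -
  have 1: "prim (f e + g e) x = prim (f e) x + prim (g e) x" if "x \<le> len G e" for x
    using prim_add[OF integrable_edge[OF assms(1)] integrable_edge[OF assms(2)] that]
    by (simp add: plus_fun_def)
  then show "prim (f e + g e) x = prim (f e) x + prim (g e) x" using assms by simp
  have "prim (prim (f e + g e)) x = prim (\<lambda>t. prim (f e) t + prim (g e) t) x"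
    using 1 assms(3) by (intro prim_cong) simp
  then show "prim (prim (f e + g e)) x = prim (prim (f e)) x + prim (prim (g e)) x"
    using prim_add[OF integrable_prim[OF assms(1)] integrable_prim[OF assms(2)] assms(3)] by simp
qed

lemma vertex_values_add:
  assumes "f \<in> L2 G" "g \<in> L2 G"
  shows "vertex_values G (f + g) = vertex_values G f + vertex_values G g"
proof (rule vertex_values_unique)
  show "vertex_operator G (vertex_values G f + vertex_values G g) = vertex_load G (f + g)"
    unfolding linear_add[OF linear_vertex_operator] vertex_operator_values
    by (simp add: vertex_load_def vec_eq_iff prim_plus[OF assms] sum.distrib sum_subtractf add_divide_distrib)
qed

lemma vertex_values_scale: "vertex_values G (c *\<^sub>R g) = c *\<^sub>R vertex_values G g"
proof (rule vertex_values_unique)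
  show "vertex_operator G (c *\<^sub>R vertex_values G g) = vertex_load G (c *\<^sub>R g)"
    unfolding linear_scale[OF linear_vertex_operator] vertex_operator_values
    by (simp add: vertex_load_def vec_eq_iff prim_scale sum_distrib_left algebra_simps)
qed

lemma green_op_add:
  assumes "f \<in> L2 G" "g \<in> L2 G"
  shows "green_op G (f + g) = green_op G f + green_op G g"
  by (intro ext) (simp add: green_op_def slope_def vertex_values_add[OF assms] prim_plus[OF assms]
      add_divide_distrib diff_divide_distrib algebra_simps)

lemma green_op_scale: "green_op G (c *\<^sub>R g) = c *\<^sub>R green_op G g"
  by (intro ext) (simp add: green_op_def slope_def vertex_values_scale prim_scale
      add_divide_distrib diff_divide_distrib algebra_simps)

lemma green_op_H2:
  assumes "g \<in> L2 G"
  shows "H2_derivs (len G e) (green_op G g e) (\<lambda>x. slope G g e - prim (g e) x) (\<lambda>x. - g e x)"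
  unfolding H2_derivs_def
proof (intro conjI ballI)
  fix x assume x: "x \<in> {0..len G e}"
  have "((\<lambda>x. vertex_values G g $ tail G e + slope G g e * x - prim (prim (g e)) x)
      has_real_derivative (0 + slope G g e * 1 - prim (g e) x)) (at x within {0..len G e})"
    using x by (intro derivative_intros prim_has_derivative prim_continuous integrable_edge assms) auto
  then show "(green_op G g e has_real_derivative slope G g e - prim (g e) x) (at x within {0..len G e})"
    unfolding add_0 mult_1_right
    by (rule has_field_derivative_transform_within[OF _ zero_less_one x]) (simp add: green_op_def)
next
  fix x assume x: "x \<in> {0..len G e}"
  show "slope G g e - prim (g e) x = slope G g e - prim (g e) 0 + (\<integral>t. - g e t \<partial>lebesgue_on {0..x})"
    by simp (simp add: prim_def)
qed (use assms in \<open>auto simp: L2_def\<close>)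

lemma neg_laplacian_green_op:
  assumes "g \<in> L2 G"
  shows "neg_laplacian G (green_op G g) g"
  unfolding neg_laplacian_def
proof (intro exI conjI allI)
  show "H2_derivs (len G e) (green_op G g e) (\<lambda>x. slope G g e - prim (g e) x) (\<lambda>x. - g e x)" for e
    by (rule green_op_H2[OF assms])
  have dir: "vertex_values G g $ v = 0" if "v \<in> dirichlet G" for v
    using arg_cong[OF vertex_operator_values[of g], of "\<lambda>h. h $ v"] that
    by (simp add: vertex_operator_def vertex_load_def)
  show "continuous_at_vertices G (green_op G g)"
    unfolding continuous_at_vertices_def
  proof (intro exI conjI allI ballI)
    show "green_op G g e 0 = (\<lambda>v. vertex_values G g $ v) (tail G e)" for e
      using prim_0[of "prim (g e)"] by (simp add: green_op_def len_nonneg)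
    show "green_op G g e (len G e) = (\<lambda>v. vertex_values G g $ v) (head G e)" for e
      using len_pos[of e] by (simp add: green_op_def slope_def)
  qed (rule dir)
  show "kirchhoff G (\<lambda>e x. slope G g e - prim (g e) x)"
    unfolding kirchhoff_def
  proof (intro allI impI)
    fix v assume v: "v \<notin> dirichlet G"
    let ?h = "vertex_values G g"
    let ?d = "\<lambda>e. (?h $ head G e - ?h $ tail G e) / len G e"
    have "(\<Sum>e | head G e = v. ?d e) - (\<Sum>e | tail G e = v. ?d e)
        = (\<Sum>e | head G e = v. prim (g e) (len G e) - prim (prim (g e)) (len G e) / len G e)
          + (\<Sum>e | tail G e = v. prim (prim (g e)) (len G e) / len G e)"
      using arg_cong[OF vertex_operator_values[of g], of "\<lambda>h. h $ v"] v
      by (simp add: vertex_operator_def vertex_load_def)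
    moreover have "slope G g e = ?d e + prim (prim (g e)) (len G e) / len G e" for e
      by (simp add: slope_def add_divide_distrib)
    ultimately show "(\<Sum>e | head G e = v. slope G g e - prim (g e) (len G e))
        + (\<Sum>e | tail G e = v. - (slope G g e - prim (g e) 0)) = 0"
      by (simp add: sum.distrib sum_subtractf sum_negf)
  qed
qed simp

end

section \<open>Compactness and injectivity of the Green operator\<close>

lemma measure_lebesgue_on_Icc [simp]:
  "a \<le> b \<Longrightarrow> measure (lebesgue_on {a..b}) {a..b} = b - (a::real)"
  by (simp add: measure_restrict_space)

lemma prim_bound:
  assumes "integrable (lebesgue_on {0..x}) g" "\<And>t. 0 \<le> t \<Longrightarrow> t \<le> x \<Longrightarrow> \<bar>g t\<bar> \<le> C" "0 \<le> x"
  shows "\<bar>prim g x\<bar> \<le> x * C"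
proof -
  have "\<bar>prim g x\<bar> \<le> (\<integral>t. \<bar>g t\<bar> \<partial>lebesgue_on {0..x})"
    unfolding prim_def by (rule integral_abs_bound)
  also have "\<dots> \<le> (\<integral>t. C \<partial>lebesgue_on {0..x})"
    using assms by (intro integral_mono) auto
  also have "\<dots> = x * C" using assms(3) by simp
  finally show ?thesis .
qed

lemma L2_inner_le_sup:
  assumes f: "f \<in> L2 G" and \<delta>: "\<And>e x. x \<in> {0..len G e} \<Longrightarrow> \<bar>f e x\<bar> \<le> \<delta>" and len: "\<And>e. 0 \<le> len G e"
  shows "L2_inner G f f \<le> \<delta>\<^sup>2 * (\<Sum>e\<in>UNIV. len G (e :: 'e::finite))"
proof -
  have "(\<integral>x. f e x * f e x \<partial>edge_measure G e) \<le> (\<integral>x. \<delta>\<^sup>2 \<partial>edge_measure G e)" for e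
  proof (rule integral_mono)
    fix x assume "x \<in> space (edge_measure G e)"
    then have "\<bar>f e x\<bar> \<le> \<delta>" using \<delta> by simp
    then have "\<bar>f e x\<bar>\<^sup>2 \<le> \<delta>\<^sup>2" by (intro power_mono) auto
    then show "f e x * f e x \<le> \<delta>\<^sup>2" by (simp add: power2_eq_square)
  qed (use f in \<open>auto intro: L2_mult_integrable\<close>)
  then have "(\<integral>x. f e x * f e x \<partial>edge_measure G e) \<le> \<delta>\<^sup>2 * len G e" for e
    using len by (simp add: mult.commute)
  then show ?thesis
    unfolding L2_inner_eq sum_distrib_left by (intro sum_mono)
qed

lemma L2_null_AE:
  assumes f: "f \<in> L2 G" and 0: "L2_inner G f f = 0"
  shows "AE x in edge_measure G e. f e x = (0::real)"
proof -
  have "(\<integral>x. f e x * f e x \<partial>edge_measure G e) = 0"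
    using 0 edge_integral_le_L2_inner[of G e f] by (intro antisym) auto
  then have "AE x in edge_measure G e. f e x * f e x = 0"
    using L2_mult_integrable[OF f f] by (subst (asm) integral_nonneg_eq_0_iff_AE) auto
  then show ?thesis by eventually_elim simp
qed

lemma L2_const: "(\<lambda>e x. c) \<in> L2 G"
  unfolding L2_iff by (intro allI continuous_square_integrable continuous_intros)

section \<open>Linearity of the Laplacian and its independence of null sets\<close>

lemma H2_derivs_cmult:
  assumes "H2_derivs l f f' f''"
  shows "H2_derivs l (\<lambda>x. c * f x) (\<lambda>x. c * f' x) (\<lambda>x. c * f'' x)"
proof -
  note r = H2_derivs_regular[OF assms]
  have "square_integrable (lebesgue_on {0..l}) (\<lambda>x. c * f'' x)"
    by (rule square_integrable_cmult[OF r(2)])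
  moreover have "c * f' x = c * f' 0 + prim (\<lambda>x. c * f'' x) x" if "x \<in> {0..l}" for x
    unfolding prim_cmult r(4)[OF that] by (rule distrib_left)
  moreover have "((\<lambda>x. c * f x) has_real_derivative c * f' x) (at x within {0..l})" if "x \<in> {0..l}" for x
    using assms that unfolding H2_derivs_def by (intro DERIV_cmult) blast
  ultimately show ?thesis
    unfolding H2_derivs_def square_integrable_def prim_def by blast
qed

lemma H2_derivs_add:
  assumes f: "H2_derivs l f f' f''" and g: "H2_derivs l g g' g''"
  shows "H2_derivs l (\<lambda>x. f x + g x) (\<lambda>x. f' x + g' x) (\<lambda>x. f'' x + g'' x)"
proof -
  note rf = H2_derivs_regular[OF f] and rg = H2_derivs_regular[OF g]
  have "square_integrable (lebesgue_on {0..l}) (\<lambda>x. f'' x + g'' x)"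
    by (rule square_integrable_add[OF rf(2) rg(2)])
  moreover have "f' x + g' x = f' 0 + g' 0 + prim (\<lambda>x. f'' x + g'' x) x" if "x \<in> {0..l}" for x
    using rf(4)[OF that] rg(4)[OF that] prim_add[OF rf(3) rg(3), of x] that
    unfolding atLeastAtMost_iff by linarith
  moreover have "((\<lambda>x. f x + g x) has_real_derivative f' x + g' x) (at x within {0..l})" if "x \<in> {0..l}" for x
    using f g that unfolding H2_derivs_def by (intro DERIV_add) blast+
  ultimately show ?thesis
    unfolding H2_derivs_def square_integrable_def prim_def by blast
qed

lemma neg_laplacian_cmult:
  assumes "neg_laplacian G u f"
  shows "neg_laplacian G (c *\<^sub>R u) (c *\<^sub>R f)"
proof -
  obtain u' u'' where u: "\<And>e. H2_derivs (len G e) (u e) (u' e) (u'' e)" "continuous_at_vertices G u"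
    "kirchhoff G u'" "\<And>e. AE x in edge_measure G e. f e x = - u'' e x"
    using assms unfolding neg_laplacian_def by blast
  show ?thesis
    unfolding neg_laplacian_def
  proof (intro exI conjI allI)
    show "H2_derivs (len G e) ((c *\<^sub>R u) e) (\<lambda>x. c * u' e x) (\<lambda>x. c * u'' e x)" for e
      using H2_derivs_cmult[OF u(1)[of e], of c] by (simp add: scaleR_fun_def)
    obtain h where h: "\<And>e. u e 0 = h (tail G e)" "\<And>e. u e (len G e) = h (head G e)"
      "\<And>v. v \<in> dirichlet G \<Longrightarrow> h v = 0"
      using u(2) unfolding continuous_at_vertices_def by blast
    then show "continuous_at_vertices G (c *\<^sub>R u)"
      unfolding continuous_at_vertices_def by (intro exI[of _ "\<lambda>v. c * h v"]) simp
    show "kirchhoff G (\<lambda>e x. c * u' e x)"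
      unfolding kirchhoff_def
    proof (intro allI impI)
      fix v assume "v \<notin> dirichlet G"
      then have "c * ((\<Sum>e | head G e = v. u' e (len G e)) + (\<Sum>e | tail G e = v. - u' e 0)) = 0"
        using u(3) unfolding kirchhoff_def by simp
      then show "(\<Sum>e | head G e = v. c * u' e (len G e)) + (\<Sum>e | tail G e = v. - (c * u' e 0)) = 0"
        by (simp add: sum_negf sum_distrib_left distrib_left right_diff_distrib)
    qed
    show "AE x in edge_measure G e. (c *\<^sub>R f) e x = - (c * u'' e x)" for e
      using u(4)[of e] by eventually_elim simp
  qed
qed

lemma neg_laplacian_AE_cong:
  assumes "neg_laplacian G u f" "\<And>e. AE x in edge_measure G e. f e x = g e x"
  shows "neg_laplacian G u g"
proof -
  obtain u' u'' where u: "\<And>e. H2_derivs (len G e) (u e) (u' e) (u'' e)" "continuous_at_vertices G u"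
    "kirchhoff G u'" "\<And>e. AE x in edge_measure G e. f e x = - u'' e x"
    using assms unfolding neg_laplacian_def by blast
  have "AE x in edge_measure G e. g e x = - u'' e x" for e
    using u(4)[of e] assms(2)[of e] by eventually_elim simp
  then show ?thesis using u(1-3) unfolding neg_laplacian_def by blast
qed

context dirichlet_graph
begin

text \<open>Integrate the elementary bound of \<open>\<bar>a\<bar>\<close> by
  \<open>1 + a * a\<close> over the whole edge.\<close>

lemma prim_unit_bound:
  assumes g: "g \<in> L2 G" "L2_inner G g g \<le> 1" and x: "x \<in> {0..len G e}"
  shows "\<bar>prim (g e) x\<bar> \<le> len G e + 1"
proof -
  have int: "integrable (edge_measure G e) (\<lambda>t. 1 + g e t * g e t)"
    by (intro Bochner_Integration.integrable_add L2_mult_integrable g) auto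
  have "\<bar>prim (g e) x\<bar> \<le> (\<integral>t. \<bar>g e t\<bar> \<partial>lebesgue_on {0..x})"
    unfolding prim_def by (rule integral_abs_bound)
  also have "\<dots> = (\<integral>t. indicator {0..x} t * \<bar>g e t\<bar> \<partial>edge_measure G e)"
    using x by (subst integral_indicator_lebesgue_on) auto
  also have "\<dots> \<le> (\<integral>t. 1 + g e t * g e t \<partial>edge_measure G e)"
  proof (rule integral_mono_AE'[OF int])
    have "\<bar>a\<bar> \<le> 1 + a * a" for a :: real
      using sum_squares_bound[of "\<bar>a\<bar>" 1] by (simp add: power2_eq_square)
    then show "AE t in edge_measure G e. indicator {0..x} t * \<bar>g e t\<bar> \<le> 1 + g e t * g e t"
      by (auto simp: indicator_def intro: add_nonneg_nonneg)
  qed (auto simp: indicator_def)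
  also have "\<dots> = (\<integral>t. 1 \<partial>edge_measure G e) + (\<integral>t. g e t * g e t \<partial>edge_measure G e)"
    by (intro Bochner_Integration.integral_add L2_mult_integrable g) auto
  also have "\<dots> \<le> len G e + 1"
    using edge_integral_le_L2_inner[of G e g] g(2) len_nonneg[of e] by simp
  finally show ?thesis .
qed

text \<open>Since \<open>slope G g e - prim (g e) x\<close> is the derivative of
  \<open>green_op G g e\<close>, the image of the unit ball is uniformly bounded and uniformly
  Lipschitz on each edge, as the Arzela-Ascoli theorem demands. The same \<open>C\<close> bounds the
  operator.\<close>

lemma green_op_unit_bound:
  obtains C where "0 \<le> C"
    "\<And>g e x. \<lbrakk>g \<in> L2 G; L2_inner G g g \<le> 1; x \<in> {0..len G e}\<rbrakk> \<Longrightarrow>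
      \<bar>green_op G g e x\<bar> \<le> C \<and> \<bar>slope G g e - prim (g e) x\<bar> \<le> C"
proof -
  define L where "L = (\<Sum>e\<in>UNIV. len G e) + 1"
  have len_le: "len G e + 1 \<le> L" for e
    unfolding L_def using member_le_sum[of e UNIV "len G"] len_nonneg by auto
  have L: "1 \<le> L" "\<And>e. len G e \<le> L"
    using len_le len_nonneg by (auto simp: L_def intro!: sum_nonneg) (smt (verit))
  \<comment> \<open>The constants follow the construction of the Green operator: \<open>L\<close>
    bounds the first and \<open>L * L\<close> the second primitive, \<open>2 * R\<close> the vertex
    load, \<open>H\<close> the inverse of the vertex operator, \<open>Z\<close> the vertex values,
    \<open>T\<close> the slopes. Sums over all edges stand in for maxima.\<close>
  define R where "R = (\<Sum>e\<in>UNIV. L + L * L / len G e)"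
  obtain H where H: "0 < H" "\<And>b. norm (inv (vertex_operator G) b) \<le> H * norm b"
  proof -
    have "linear (inv (vertex_operator G))"
      using inj_linear_imp_inv_linear[OF linear_vertex_operator inj_vertex_operator] .
    then show thesis using that linear_bounded_pos by blast
  qed
  define Z where "Z = H * (real CARD('v) * (2 * R))"
  define T where "T = (\<Sum>e\<in>UNIV. (2 * Z + L * L) / len G e)"
  define C where "C = Z + T * L + L * L + T + L"
  have R: "L + L * L / len G e \<le> R" for e
    unfolding R_def by (rule member_le_sum) (use L len_nonneg in auto)
  then have R0: "0 \<le> R" unfolding R_def using L len_nonneg by (intro sum_nonneg) auto
  then have Z0: "0 \<le> Z" using H by (simp add: Z_def)
  have T: "(2 * Z + L * L) / len G e \<le> T" for e
    unfolding T_def by (rule member_le_sum) (use L Z0 len_nonneg in auto)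
  have T0: "0 \<le> T" unfolding T_def using L Z0 len_nonneg by (intro sum_nonneg) auto
  have bound: "\<bar>green_op G g e x\<bar> \<le> C \<and> \<bar>slope G g e - prim (g e) x\<bar> \<le> C"
    if g: "g \<in> L2 G" "L2_inner G g g \<le> 1" and x: "x \<in> {0..len G e}" for g e x
  proof -
    have P: "\<bar>prim (g e) x\<bar> \<le> L" if "x \<in> {0..len G e}" for e x
      using prim_unit_bound[OF g that] len_le[of e] by linarith
    have Q: "\<bar>prim (prim (g e)) x\<bar> \<le> L * L" if x: "x \<in> {0..len G e}" for e x
    proof -
      have "\<bar>prim (prim (g e)) x\<bar> \<le> x * L"
        using x by (intro prim_bound P integrable_lebesgue_on_subinterval[OF integrable_prim[OF g(1), of e]]) auto
      also have "\<dots> \<le> L * L" using x L(1) L(2)[of e] by (intro mult_right_mono) auto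
      finally show ?thesis .
    qed
    have Ql: "\<bar>prim (prim (g e)) (len G e) / len G e\<bar> \<le> L * L / len G e" for e
      using Q[of "len G e" e] len_pos[of e] by (simp add: divide_right_mono)
    have "\<bar>vertex_load G g $ v\<bar> \<le> 2 * R" for v
    proof -
      have "\<bar>\<Sum>e | head G e = v. prim (g e) (len G e) - prim (prim (g e)) (len G e) / len G e\<bar>
          \<le> (\<Sum>e | head G e = v. L + L * L / len G e)"
        using P Ql len_nonneg
        by (intro order.trans[OF sum_abs] sum_mono order.trans[OF abs_triangle_ineq4] add_mono) auto
      also have "\<dots> \<le> R"
        unfolding R_def using L len_nonneg by (intro sum_mono2) auto
      finally have 1: "\<bar>\<Sum>e | head G e = v. prim (g e) (len G e) - prim (prim (g e)) (len G e) / len G e\<bar> \<le> R" .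
      have "\<bar>\<Sum>e | tail G e = v. prim (prim (g e)) (len G e) / len G e\<bar>
          \<le> (\<Sum>e | tail G e = v. L + L * L / len G e)"
        using L by (intro order.trans[OF sum_abs] sum_mono order.trans[OF Ql]) auto
      also have "\<dots> \<le> R"
        unfolding R_def using L len_nonneg by (intro sum_mono2) auto
      finally have 2: "\<bar>\<Sum>e | tail G e = v. prim (prim (g e)) (len G e) / len G e\<bar> \<le> R" .
      show ?thesis
        using R0 order.trans[OF abs_triangle_ineq add_mono[OF 1 2]] by (simp add: vertex_load_def)
    qed
    then have "(\<Sum>v\<in>UNIV. \<bar>vertex_load G g $ v\<bar>) \<le> real CARD('v) * (2 * R)"
      using sum_bounded_above[of UNIV "\<lambda>v. \<bar>vertex_load G g $ v\<bar>" "2 * R"] by simp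
    then have "norm (vertex_load G g) \<le> real CARD('v) * (2 * R)"
      using norm_le_l1_cart[of "vertex_load G g"] by simp
    then have "norm (vertex_values G g) \<le> Z"
      using H(2)[of "vertex_load G g"] H(1) unfolding Z_def vertex_values_def
      by (smt (verit) mult_left_mono)
    then have h: "\<bar>vertex_values G g $ v\<bar> \<le> Z" for v
      using component_le_norm_cart[of "vertex_values G g" v] by linarith
    have s: "\<bar>slope G g e\<bar> \<le> T"
    proof -
      have "\<bar>vertex_values G g $ head G e - vertex_values G g $ tail G e + prim (prim (g e)) (len G e)\<bar> \<le> 2 * Z + L * L"
        using h[of "head G e"] h[of "tail G e"] Q[of "len G e" e] len_nonneg[of e] by auto
      then have "\<bar>slope G g e\<bar> \<le> (2 * Z + L * L) / len G e"
        unfolding slope_def using len_pos[of e] by (simp add: divide_right_mono)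
      then show ?thesis using T[of e] by linarith
    qed
    have "\<bar>slope G g e * x\<bar> \<le> T * L"
      unfolding abs_mult using s x L(2)[of e] T0 by (intro mult_mono) auto
    then have "\<bar>green_op G g e x\<bar> \<le> Z + T * L + L * L"
      using h[of "tail G e"] Q[OF x] x by (simp add: green_op_def)
    moreover have "\<bar>slope G g e - prim (g e) x\<bar> \<le> T + L"
      using s P[OF x] by linarith
    moreover have "0 \<le> T * L" "0 \<le> L * L" using T0 L by auto
    ultimately show ?thesis unfolding C_def using Z0 T0 L(1) by linarith
  qed
  have "0 \<le> C" using Z0 T0 L(1) by (simp add: C_def)
  then show thesis using bound that by blast
qed

lemma green_op_L2: "g \<in> L2 G \<Longrightarrow> green_op G g \<in> L2 G"
  by (rule neg_laplacian_mem_L2[OF neg_laplacian_green_op])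

text \<open>All edges are rescaled to the unit interval and collected in one vector valued function,
  so a single application of Arzela-Ascoli treats them simultaneously. Uniform convergence on a
  graph of finite total length gives convergence in the mean.\<close>

lemma green_op_compact:
  assumes X: "\<And>n. X n \<in> L2 G \<and> L2_inner G (X n) (X n) \<le> 1"
  shows "\<exists>r :: nat \<Rightarrow> nat. strict_mono r \<and>
    semi_inner_space.is_cauchy (L2_inner G) (\<lambda>n. green_op G (X (r n)))"
proof -
  interpret semi_inner_space "L2 G" "L2_inner G" by (rule semi_inner_space_L2)
  obtain C where C: "0 \<le> C" "\<And>g e x. \<lbrakk>g \<in> L2 G; L2_inner G g g \<le> 1; x \<in> {0..len G e}\<rbrakk> \<Longrightarrow>
      \<bar>green_op G g e x\<bar> \<le> C \<and> \<bar>slope G g e - prim (g e) x\<bar> \<le> C"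
    by (rule green_op_unit_bound) blast
  define F :: "nat \<Rightarrow> real \<Rightarrow> real ^ 'e" where
    "F n t = (\<chi> e. green_op G (X n) e (len G e * t))" for n t
  define Q where "Q = (\<Sum>e\<in>UNIV. C * len G e)"
  have Q: "0 \<le> Q" unfolding Q_def using C(1) len_nonneg by (intro sum_nonneg) auto
  have in_edge: "len G e * t \<in> {0..len G e}" if "t \<in> {0..1}" for e t
    using that len_pos[of e] by (auto simp: mult_le_cancel_left1)
  have lip: "\<bar>green_op G (X n) e x - green_op G (X n) e y\<bar> \<le> C * \<bar>x - y\<bar>"
    if "x \<in> {0..len G e}" "y \<in> {0..len G e}" for n e x y
  proof -
    have "norm (green_op G (X n) e x - green_op G (X n) e y) \<le> C * norm (x - y)"
    proof (rule field_differentiable_bound[of "{0..len G e}"])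
      fix z assume z: "z \<in> {0..len G e}"
      have "H2_derivs (len G e) (green_op G (X n) e) (\<lambda>x. slope G (X n) e - prim (X n e) x) (\<lambda>x. - X n e x)"
        using X by (intro green_op_H2) blast
      then show "(green_op G (X n) e has_real_derivative slope G (X n) e - prim (X n e) z) (at z within {0..len G e})"
        using z unfolding H2_derivs_def by blast
      show "norm (slope G (X n) e - prim (X n e) z) \<le> C"
        using C(2) X z unfolding real_norm_def by blast
    qed (use that in auto)
    then show ?thesis by simp
  qed
  have F_lip: "norm (F n s - F n t) \<le> Q * \<bar>s - t\<bar>" if "s \<in> {0..1}" "t \<in> {0..1}" for n s t
  proof -
    have "\<bar>(F n s - F n t) $ e\<bar> \<le> C * len G e * \<bar>s - t\<bar>" for e
      using lip[OF in_edge[OF that(1)] in_edge[OF that(2)], of n e] len_nonneg[of e]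
      by (simp add: F_def right_diff_distrib[symmetric] abs_mult)
    then have "(\<Sum>e\<in>UNIV. \<bar>(F n s - F n t) $ e\<bar>) \<le> Q * \<bar>s - t\<bar>"
      unfolding Q_def sum_distrib_right by (intro sum_mono)
    then show ?thesis using norm_le_l1_cart[of "F n s - F n t"] by linarith
  qed
  obtain g and r :: "nat \<Rightarrow> nat" where r: "strict_mono r"
    and lim: "\<And>\<epsilon>. 0 < \<epsilon> \<Longrightarrow> \<exists>N. \<forall>n x. n \<ge> N \<and> x \<in> {0..1} \<longrightarrow> norm (F (r n) x - g x) < \<epsilon>"
  proof (rule Arzela_Ascoli[of "{0..1::real}" F "real CARD('e) * C"])
    show "norm (F n t) \<le> real CARD('e) * C" if "t \<in> {0..1}" for n t
    proof -
      have "(\<Sum>e\<in>UNIV. \<bar>F n t $ e\<bar>) \<le> real CARD('e) * C"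
        using C(2) X in_edge[OF that] by (intro sum_bounded_above) (auto simp: F_def)
      then show ?thesis using norm_le_l1_cart[of "F n t"] by linarith
    qed
    show "\<exists>d. 0 < d \<and> (\<forall>n y. y \<in> {0..1} \<and> norm (t - y) < d \<longrightarrow> norm (F n t - F n y) < \<epsilon>)"
      if t: "t \<in> {0..1}" and "0 < \<epsilon>" for t \<epsilon>
    proof (intro exI conjI allI impI)
      show "0 < \<epsilon> / (Q + 1)" using Q \<open>0 < \<epsilon>\<close> by simp
      fix n y assume y: "y \<in> {0..1} \<and> norm (t - y) < \<epsilon> / (Q + 1)"
      then have "(Q + 1) * \<bar>t - y\<bar> < \<epsilon>" using Q by (simp add: field_simps)
      moreover have "norm (F n t - F n y) \<le> Q * \<bar>t - y\<bar>" using F_lip t y by blast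
      ultimately show "norm (F n t - F n y) < \<epsilon>" by (simp add: distrib_right)
    qed
  qed (auto intro: that)
  define \<Lambda> where "\<Lambda> = (\<Sum>e\<in>UNIV. len G e)"
  have \<Lambda>: "0 \<le> \<Lambda>" unfolding \<Lambda>_def using len_nonneg by (intro sum_nonneg)
  have "is_cauchy (\<lambda>n. green_op G (X (r n)))"
    unfolding is_cauchy_def
  proof (intro allI impI)
    fix \<epsilon> :: real assume \<epsilon>: "0 < \<epsilon>"
    \<comment> \<open>Two functions within \<delta> of the limit differ by at most
      \<open>2 * \<delta>\<close>, and \<open>(2 * \<delta>)\<^sup>2 * \<Lambda>\<close> is
      \<epsilon> times \<open>\<Lambda> / (\<Lambda> + 1)\<close>, which is strictly below
      \<epsilon>.\<close>
    define \<delta> where "\<delta> = sqrt (\<epsilon> / (\<Lambda> + 1)) / 2"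
    have "0 < \<delta>" using \<epsilon> \<Lambda> by (simp add: \<delta>_def)
    then obtain N where N: "\<And>n x. N \<le> n \<Longrightarrow> x \<in> {0..1} \<Longrightarrow> norm (F (r n) x - g x) < \<delta>"
      using lim by meson
    have "L2_inner G (green_op G (X (r m)) - green_op G (X (r n))) (green_op G (X (r m)) - green_op G (X (r n))) < \<epsilon>"
      if "N \<le> m" "N \<le> n" for m n
    proof -
      have "\<bar>(green_op G (X (r m)) - green_op G (X (r n))) e x\<bar> \<le> 2 * \<delta>" if x: "x \<in> {0..len G e}" for e x
      proof -
        define t where "t = x / len G e"
        have t: "t \<in> {0..1}" "x = len G e * t" using x len_pos[of e] by (auto simp: t_def)
        have "(green_op G (X (r m)) - green_op G (X (r n))) e x = (F (r m) t - F (r n) t) $ e"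
          by (simp add: F_def t(2))
        also have "\<bar>\<dots>\<bar> \<le> norm (F (r m) t - F (r n) t)" by (rule component_le_norm_cart)
        also have "\<dots> \<le> norm (F (r m) t - g t) + norm (F (r n) t - g t)"
          using norm_triangle_ineq4[of "F (r m) t - g t" "F (r n) t - g t"] by simp
        also have "\<dots> \<le> 2 * \<delta>"
          using N[OF \<open>N \<le> m\<close> t(1)] N[OF \<open>N \<le> n\<close> t(1)] by linarith
        finally show ?thesis .
      qed
      then have "L2_inner G (green_op G (X (r m)) - green_op G (X (r n))) (green_op G (X (r m)) - green_op G (X (r n)))
          \<le> (2 * \<delta>)\<^sup>2 * \<Lambda>"
        unfolding \<Lambda>_def using X len_nonneg by (intro L2_inner_le_sup mem(3) green_op_L2) blast+
      also have "\<dots> = \<epsilon> * (\<Lambda> / (\<Lambda> + 1))"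
        using \<epsilon> \<Lambda> by (simp add: \<delta>_def power_divide)
      also have "\<dots> < \<epsilon> * 1"
        using \<epsilon> \<Lambda> by (intro mult_strict_left_mono) auto
      finally show ?thesis by simp
    qed
    then show "\<exists>N. \<forall>m\<ge>N. \<forall>n\<ge>N. L2_inner G (green_op G (X (r m)) - green_op G (X (r n)))
        (green_op G (X (r m)) - green_op G (X (r n))) < \<epsilon>"
      by blast
  qed
  then show ?thesis using r by blast
qed

text \<open>A continuous null function vanishes on the whole edge, and so does its derivative. At
  the tail this gives slope 0, whence \<open>prim (g e)\<close> vanishes identically.\<close>

lemma green_op_injective:
  assumes g: "g \<in> L2 G" and 0: "L2_inner G (green_op G g) (green_op G g) = 0"
  shows "L2_inner G g g = 0"
proof -
  have ae: "AE x in edge_measure G e. g e x = 0" for e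
  proof -
    note H2 = green_op_H2[OF g, of e]
    have "(\<integral>x. green_op G g e x * green_op G g e x \<partial>edge_measure G e) = 0"
      using 0 edge_integral_le_L2_inner[of G e "green_op G g"] by (intro antisym) auto
    then have null: "green_op G g e x = 0" if "x \<in> {0..len G e}" for x
      using that H2_derivs_regular(1)[OF H2] len_pos[of e]
      by (subst (asm) integralL_eq_0_iff) (auto intro!: continuous_intros)
    have s: "slope G g e - prim (g e) x = 0" if x: "x \<in> {0..len G e}" for x
    proof -
      have "(green_op G g e has_real_derivative slope G g e - prim (g e) x) (at x within {0..len G e})"
        using H2 x unfolding H2_derivs_def by blast
      moreover have "(green_op G g e has_real_derivative 0) (at x within {0..len G e})"
        by (rule has_field_derivative_transform_within[OF DERIV_const zero_less_one x]) (simp add: null)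
      moreover have "at x within {0..len G e} \<noteq> bot"
        using x len_pos[of e] by (simp add: trivial_limit_within islimpt_Icc)
      ultimately show ?thesis using has_field_derivative_unique by blast
    qed
    have "slope G g e = 0" using s[of 0] len_nonneg[of e] by simp
    then have "prim (g e) x = 0" if "x \<in> {0..len G e}" for x using s[OF that] by simp
    then show ?thesis
      by (intro AE_eq_0_if_prim_eq_0 integrable_edge g len_nonneg)
  qed
  have "(\<integral>x. g e x * g e x \<partial>edge_measure G e) = 0" for e
    using ae[of e] by (intro integral_eq_zero_AE) (auto elim!: eventually_mono)
  then show ?thesis by (simp add: L2_inner_eq)
qed

end

section \<open>Eigenbases and torsion functions\<close>

context dirichlet_graph
begin

text \<open>Normalised indicators of infinitely many disjoint intervals on a single edge. The end
  points are \<open>l\<close> divided by consecutive integers, with every second gap left out, so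
  the closed intervals do not touch.\<close>

lemma exists_orthonormal_sequence:
  "\<exists>\<psi> :: nat \<Rightarrow> 'e graph_fun. semi_inner_space.orthonormal (L2 G) (L2_inner G) UNIV \<psi>"
proof -
  interpret semi_inner_space "L2 G" "L2_inner G" by (rule semi_inner_space_L2)
  obtain e0 :: 'e where True by blast
  define l where "l = len G e0"
  define a where "a n = l / (2 * real n + 2)" for n
  define b where "b n = l / (2 * real n + 1)" for n
  define \<psi> :: "nat \<Rightarrow> 'e graph_fun" where
    "\<psi> n e x = (if e = e0 then indicator {a n..b n} x / sqrt (b n - a n) else 0)" for n e x
  have l: "0 < l" by (simp add: l_def len_pos)
  have ab: "a n < b n" for n unfolding a_def b_def using l by (intro divide_strict_left_mono) auto
  have sub: "{a n..b n} \<subseteq> {0..l}" for n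
    unfolding a_def b_def using l by (auto simp: field_simps)
  have disj: "b m < a n" if "n < m" for m n
  proof -
    have "2 * real n + 2 < 2 * real m + 1" using that by simp
    then show ?thesis unfolding a_def b_def using l by (intro divide_strict_left_mono) auto
  qed
  have mem_L2: "\<psi> n \<in> L2 G" for n
    unfolding L2_iff
  proof
    fix e
    show "square_integrable (edge_measure G e) (\<psi> n e)"
    proof (cases "e = e0")
      case True
      have ind: "integrable (lebesgue_on {0..l}) (indicator {a n..b n} :: real \<Rightarrow> real)"
        using sub[of n] by (intro integrable_real_indicator)
          (auto simp: emeasure_restrict_space sets_restrict_space_iff emeasure_lborel_Icc_eq)
      have "\<psi> n e0 = (\<lambda>x. (1 / sqrt (b n - a n)) * indicator {a n..b n} x)"
        by (simp add: \<psi>_def fun_eq_iff)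
      moreover have "square_integrable (lebesgue_on {0..l}) (indicator {a n..b n})"
        using ind by (simp add: square_integrable_def power2_eq_square flip: indicator_inter_arith)
      ultimately show ?thesis
        using True by (simp only: l_def[symmetric] square_integrable_cmult)
    next
      case False
      then have "\<psi> n e = (\<lambda>x. 0)" by (simp add: \<psi>_def fun_eq_iff)
      then show ?thesis by (simp add: square_integrable_def)
    qed
  qed
  have "L2_inner G (\<psi> m) (\<psi> n) = (if m = n then 1 else 0)" for m n
  proof -
    have "L2_inner G (\<psi> m) (\<psi> n) = (\<Sum>e\<in>UNIV. if e = e0 then
        (\<integral>x. \<psi> m e0 x * \<psi> n e0 x \<partial>lebesgue_on {0..l}) else 0)"
      unfolding L2_inner_eq by (intro sum.cong) (auto simp: l_def, simp add: \<psi>_def)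
    then have eq: "L2_inner G (\<psi> m) (\<psi> n) = (\<integral>x. \<psi> m e0 x * \<psi> n e0 x \<partial>lebesgue_on {0..l})"
      by simp
    show ?thesis
    proof (cases "m = n")
      case True
      have sq: "\<psi> n e0 x * \<psi> n e0 x = indicator {a n..b n} x * (1 / (b n - a n))" for x
        using ab[of n] by (auto simp: \<psi>_def indicator_def)
      have "L2_inner G (\<psi> m) (\<psi> n) = (\<integral>x. indicator {a n..b n} x * (1 / (b n - a n)) \<partial>lebesgue_on {0..l})"
        unfolding eq by (simp only: True sq)
      also have "\<dots> = (\<integral>x. 1 / (b n - a n) \<partial>lebesgue_on {a n..b n})"
        by (rule integral_indicator_lebesgue_on[OF sub])
      finally show ?thesis using ab[of n] True by (simp add: less_imp_le)
    next
      case False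
      have "indicator {a m..b m} x * indicator {a n..b n} x = (0::real)" for x
        using False disj[of m n] disj[of n m] by (cases m n rule: linorder_cases) (auto simp: indicator_def)
      then have prod: "\<psi> m e0 x * \<psi> n e0 x = 0" for x by (simp add: \<psi>_def)
      show ?thesis using False by (simp add: eq prod)
    qed
  qed
  then have "orthonormal UNIV \<psi>" using mem_L2 by (simp add: orthonormal_def)
  then show ?thesis by blast
qed

theorem exists_eigenbasis: "\<exists>lam phi. eigenbasis G lam phi"
proof -
  obtain C where C: "0 \<le> C" "\<And>g e x. \<lbrakk>g \<in> L2 G; L2_inner G g g \<le> 1; x \<in> {0..len G e}\<rbrakk> \<Longrightarrow>
      \<bar>green_op G g e x\<bar> \<le> C \<and> \<bar>slope G g e - prim (g e) x\<bar> \<le> C"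
    by (rule green_op_unit_bound) blast
  obtain \<psi> :: "nat \<Rightarrow> 'e graph_fun" where \<psi>: "semi_inner_space.orthonormal (L2 G) (L2_inner G) UNIV \<psi>"
    using exists_orthonormal_sequence by blast
  interpret complete_semi_inner_space "L2 G" "L2_inner G" by (rule complete_semi_inner_space_L2)
  interpret compact_positive_operator "L2 G" "L2_inner G" "green_op G" "C\<^sup>2 * (\<Sum>e\<in>UNIV. len G e)" \<psi>
  proof
    show "L2_inner G (green_op G x) y = L2_inner G (green_op G y) x" if "x \<in> L2 G" "y \<in> L2 G" for x y
      using neg_laplacian_green(1)[OF neg_laplacian_green_op[OF that(1)] that(1)
          neg_laplacian_green_op[OF that(2)] that(2) len_nonneg] that
      by (simp add: commute green_op_L2)
    show "0 \<le> L2_inner G (green_op G x) x" if "x \<in> L2 G" for x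
      using neg_laplacian_green(2)[OF neg_laplacian_green_op[OF that] that
          neg_laplacian_green_op[OF that] that len_nonneg] that
      by (simp add: commute green_op_L2)
    show "L2_inner G (green_op G x) (green_op G x) \<le> C\<^sup>2 * (\<Sum>e\<in>UNIV. len G e)"
      if "x \<in> L2 G" "L2_inner G x x \<le> 1" for x
      using C(2)[OF that] by (intro L2_inner_le_sup green_op_L2 that len_nonneg) blast
    show "\<exists>r :: nat \<Rightarrow> nat. strict_mono r \<and> is_cauchy (\<lambda>n. green_op G (X (r n)))"
      if "\<And>n. X n \<in> L2 G \<and> L2_inner G (X n) (X n) \<le> 1" for X
      using that by (rule green_op_compact)
  qed (rule green_op_L2 green_op_add green_op_scale green_op_injective \<psi>; assumption)+
  obtain \<mu> \<phi> where ev: "\<And>n. eigenpair (\<mu> n) (\<phi> n)" and dec: "decseq \<mu>" and lim: "\<mu> \<longlonglongrightarrow> 0"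
    and on: "orthonormal UNIV \<phi>"
    and expand: "\<And>f. f \<in> L2 G \<Longrightarrow> converges (\<lambda>N. \<Sum>n<N. L2_inner G f (\<phi> n) *\<^sub>R \<phi> n) f"
    by (rule spectral_theorem) blast
  have \<mu>: "0 < \<mu> n" and \<phi>: "\<phi> n \<in> L2 G" for n using ev[of n] by (auto simp: eigenpair_def)
  define lam where "lam n = 1 / \<mu> n" for n
  \<comment> \<open>Differs from \<open>\<phi> n\<close> by a null vector, hence has the same inner
    products, but as an image of the Green operator it satisfies the vertex conditions and has the
    required derivatives.\<close>
  define phi where "phi n = lam n *\<^sub>R green_op G (\<phi> n)" for n
  have phi: "phi n \<in> L2 G" for n using \<phi> by (auto simp: phi_def green_op_L2)
  have diff: "phi n - \<phi> n = lam n *\<^sub>R (green_op G (\<phi> n) - \<mu> n *\<^sub>R \<phi> n)" for n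
    using \<mu>[of n] by (simp add: phi_def lam_def scaleR_diff_right)
  have null: "L2_inner G (phi n - \<phi> n) (phi n - \<phi> n) = 0" for n
    unfolding diff using ev[of n] \<phi> by (subst scale_sq) (auto simp: eigenpair_def green_op_L2)
  have phi_inner: "L2_inner G y (phi n) = L2_inner G y (\<phi> n)" if "y \<in> L2 G" for y n
  proof -
    have "L2_inner G y (phi n - \<phi> n) = 0"
      using null_left[OF _ that null] commute[OF that] phi \<phi> by auto
    then show ?thesis using that phi \<phi> by (simp add: diff_right)
  qed
  have "eigenbasis G lam phi"
    unfolding eigenbasis_def
  proof (intro conjI allI ballI)
    show "0 < lam n" for n using \<mu> by (simp add: lam_def)
    show "incseq lam"
    proof (rule incseq_SucI)
      show "lam n \<le> lam (Suc n)" for n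
        unfolding lam_def using \<mu> dec by (intro divide_left_mono) (auto simp: decseq_Suc_iff)
    qed
    have "filterlim \<mu> (at_right 0) sequentially"
      using lim \<mu> by (simp add: filterlim_at less_imp_neq[THEN not_sym])
    then show "filterlim lam at_top sequentially"
      unfolding lam_def using filterlim_compose[OF filterlim_inverse_at_top_right, of \<mu>]
      by (simp add: inverse_eq_divide)
    show "neg_laplacian G (phi n) (\<lambda>e x. lam n * phi n e x)" for n
    proof (rule neg_laplacian_AE_cong)
      show "neg_laplacian G (phi n) (lam n *\<^sub>R \<phi> n)"
        unfolding phi_def by (rule neg_laplacian_cmult[OF neg_laplacian_green_op[OF \<phi>]])
      show "AE x in edge_measure G e. (lam n *\<^sub>R \<phi> n) e x = lam n * phi n e x" for e
        using L2_null_AE[OF mem(3)[OF phi[of n] \<phi>[of n]] null[of n], where e = e] by eventually_elim simp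
    qed
    show "L2_inner G (phi m) (phi n) = (if m = n then 1 else 0)" for m n
      using on phi_inner[OF phi, of m n] phi_inner[OF \<phi>, of n m] phi \<phi>
      by (simp add: commute[of "phi m" "\<phi> n"] orthonormal_def)
    fix f assume f: "f \<in> L2 G"
    have coeff: "(\<lambda>e x. L2_inner G f (phi n) * phi n e x) = L2_inner G f (phi n) *\<^sub>R phi n" for n
      by (simp add: fun_eq_iff)
    let ?X = "\<lambda>N. \<Sum>n<N. L2_inner G f (\<phi> n) *\<^sub>R \<phi> n" and ?Y = "\<lambda>N. \<Sum>n<N. L2_inner G f (phi n) *\<^sub>R phi n"
    have XY: "L2_inner G (?X N - ?Y N) y = 0" if "y \<in> L2 G" for N y
    proof -
      have "L2_inner G (phi n) y = L2_inner G (\<phi> n) y" for n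
        using phi_inner[OF that, of n] commute[OF that phi] commute[OF that \<phi>] by simp
      then show ?thesis
        using that phi \<phi> f by (simp add: diff_left sum_left scale_left phi_inner)
    qed
    have "converges ?Y f"
    proof (rule converges_add_null[OF expand[OF f]])
      show "(\<lambda>N. L2_inner G (?X N - ?Y N) (?X N - ?Y N)) \<longlonglongrightarrow> 0"
        using phi \<phi> by (subst XY) auto
    qed (use phi \<phi> f in auto)
    then show "L2_sums G (\<lambda>n e x. L2_inner G f (phi n) * phi n e x) f"
      using f phi by (subst L2_sums_iff) (auto simp: coeff)
  qed
  then show ?thesis by blast
qed

lemma eigenbasis_eig: "eigenbasis G (eigval G) (eigfun G)"
proof -
  have "\<exists>p. case p of (lam, phi) \<Rightarrow> eigenbasis G lam phi" using exists_eigenbasis by auto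
  then have "case spectral_data G of (lam, phi) \<Rightarrow> eigenbasis G lam phi"
    unfolding spectral_data_def by (rule someI_ex)
  then show ?thesis by (simp add: eigval_def eigfun_def split_beta)
qed

sublocale complete_semi_inner_space "L2 G" "L2_inner G"
  by (rule complete_semi_inner_space_L2)

lemma eigval_pos: "0 < eigval G n"
  and eigval_mono: "incseq (eigval G)"
  and eigfun_laplacian: "neg_laplacian G (eigfun G n) (\<lambda>e x. eigval G n * eigfun G n e x)"
  using eigenbasis_eig by (auto simp: eigenbasis_def)

lemma eigfun_L2 [simp, intro]: "eigfun G n \<in> L2 G"
  by (rule neg_laplacian_mem_L2[OF eigfun_laplacian])

lemma eigfun_orthonormal: "orthonormal UNIV (eigfun G)"
  using eigenbasis_eig by (simp add: eigenbasis_def orthonormal_def)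

lemma eigfun_expansion:
  assumes "f \<in> L2 G"
  shows "converges (\<lambda>N. \<Sum>n<N. L2_inner G f (eigfun G n) *\<^sub>R eigfun G n) f"
proof -
  have "(\<lambda>e x. L2_inner G f (eigfun G n) * eigfun G n e x) = L2_inner G f (eigfun G n) *\<^sub>R eigfun G n" for n
    by (simp add: fun_eq_iff)
  then show ?thesis
    using eigenbasis_eig assms L2_sums_iff[of "\<lambda>n. L2_inner G f (eigfun G n) *\<^sub>R eigfun G n" G f]
    by (auto simp: eigenbasis_def)
qed

lemma parseval:
  assumes "f \<in> L2 G" "g \<in> L2 G"
  shows "(\<lambda>n. L2_inner G f (eigfun G n) * L2_inner G (eigfun G n) g) sums L2_inner G f g"
  using expansion_sums[OF eigfun_expansion[OF assms(1)] _ assms] by blast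

section \<open>Torsion functions described by their coefficients\<close>

abbreviation one :: "'e graph_fun" where "one \<equiv> \<lambda>e x. 1"

text \<open>Orthonormality identifies the coefficients of a series that converges to
  \<open>one\<close>; conversely, with these coefficients the series is the eigenfunction expansion
  of \<open>one\<close>. The summability condition becomes Bessel's inequality for
  \<open>one\<close>.\<close>

lemma frac_laplacian_one_iff:
  "frac_laplacian G \<alpha> u one \<longleftrightarrow>
    u \<in> L2 G \<and> (\<forall>n. eigval G n powr \<alpha> * L2_inner G u (eigfun G n) = L2_inner G one (eigfun G n))"
proof -
  let ?c = "\<lambda>n. eigval G n powr \<alpha> * L2_inner G u (eigfun G n)"
  have coeff: "(\<lambda>e x. ?c n * eigfun G n e x) = ?c n *\<^sub>R eigfun G n" for n
    by (simp add: fun_eq_iff)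
  have sums_iff: "L2_sums G (\<lambda>n e x. ?c n * eigfun G n e x) one
      \<longleftrightarrow> converges (\<lambda>N. \<Sum>n<N. ?c n *\<^sub>R eigfun G n) one"
    unfolding coeff by (rule L2_sums_iff) (auto simp: L2_const)
  have "?c m = L2_inner G one (eigfun G m)"
    if conv: "converges (\<lambda>N. \<Sum>n<N. ?c n *\<^sub>R eigfun G n) one" for m
  proof -
    have "(\<lambda>n. ?c n * L2_inner G (eigfun G n) (eigfun G m)) sums L2_inner G one (eigfun G m)"
      by (rule expansion_sums[OF conv]) (auto simp: L2_const)
    moreover have "(\<lambda>n. ?c n * L2_inner G (eigfun G n) (eigfun G m)) = (\<lambda>n. if n = m then ?c n else 0)"
      using eigfun_orthonormal by (auto simp: orthonormal_def fun_eq_iff)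
    ultimately show ?thesis using sums_unique2[OF sums_single[of m ?c]] by (simp only:)
  qed
  moreover have "summable (\<lambda>n. eigval G n powr (2 * \<alpha>) * (L2_inner G u (eigfun G n))\<^sup>2)"
    if "\<And>n. ?c n = L2_inner G one (eigfun G n)"
  proof -
    have "eigval G n powr (2 * \<alpha>) * (L2_inner G u (eigfun G n))\<^sup>2 = (?c n)\<^sup>2" for n
      by (simp add: power_mult_distrib power2_eq_square flip: powr_add)
    then show ?thesis
      using bessel_summable[OF eigfun_orthonormal L2_const, of 1] that by simp
  qed
  moreover have "converges (\<lambda>N. \<Sum>n<N. ?c n *\<^sub>R eigfun G n) one"
    if "\<And>n. ?c n = L2_inner G one (eigfun G n)"
    unfolding that by (rule eigfun_expansion[OF L2_const])
  ultimately show ?thesis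
    unfolding frac_laplacian_def sums_iff using L2_const by blast
qed

text \<open>The eigenvalues are bounded below by the first one, so
  \<open>eigval G n powr - \<alpha>\<close> is bounded and the prescribed coefficients remain square
  summable.\<close>

lemma exists_torsion:
  assumes "0 < \<alpha>"
  shows "\<exists>u. frac_laplacian G \<alpha> u one"
proof -
  let ?d = "\<lambda>n. L2_inner G one (eigfun G n)"
  have le: "(eigval G n powr - \<alpha> * ?d n)\<^sup>2 \<le> (eigval G 0 powr - \<alpha>)\<^sup>2 * (?d n)\<^sup>2" for n
  proof -
    have "eigval G n powr - \<alpha> \<le> eigval G 0 powr - \<alpha>"
      using assms eigval_pos eigval_mono by (intro powr_mono2') (auto simp: incseq_def)
    then show ?thesis
      unfolding power_mult_distrib by (intro mult_right_mono power_mono) auto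
  qed
  have "summable (\<lambda>n. (eigval G 0 powr - \<alpha>)\<^sup>2 * (?d n)\<^sup>2)"
    by (intro summable_mult bessel_summable eigfun_orthonormal L2_const)
  then have c: "summable (\<lambda>n. (eigval G n powr - \<alpha> * ?d n)\<^sup>2)"
    by (rule summable_comparison_test'[where N = 0]) (use le in simp)
  obtain u where u: "u \<in> L2 G" "\<And>n. L2_inner G u (eigfun G n) = eigval G n powr - \<alpha> * ?d n"
    by (rule bexE[OF riesz_fischer[OF eigfun_orthonormal c]]) (elim conjE, rule that, assumption, erule spec)
  have "eigval G n powr \<alpha> * L2_inner G u (eigfun G n) = ?d n" for n
  proof -
    have "eigval G n powr \<alpha> * eigval G n powr - \<alpha> = 1"
      using eigval_pos[of n] by (simp flip: powr_add)
    then show ?thesis unfolding u(2) mult.assoc[symmetric] by simp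
  qed
  then show ?thesis using u(1) frac_laplacian_one_iff by blast
qed

lemma graph_integral_eq_inner: "graph_integral G u = L2_inner G u one"
  by (simp add: L2_inner_def)

text \<open>All torsion functions have the same coefficients, hence by Parseval the same pairing
  with \<open>one\<close>. The rigidity can therefore be computed from any convenient one, such as a
  lifted function.\<close>

lemma torsional_rigidity_eq:
  assumes u: "frac_laplacian G \<alpha> u one"
  shows "torsional_rigidity G \<alpha> = graph_integral G u"
proof -
  let ?v = "torsion_function G \<alpha>"
  have v: "frac_laplacian G \<alpha> ?v one"
    unfolding torsion_function_def using u by (rule someI[of "\<lambda>u. frac_laplacian G \<alpha> u one"])
  have L2: "u \<in> L2 G" "?v \<in> L2 G" using u v by (auto simp: frac_laplacian_one_iff)
  have "L2_inner G ?v (eigfun G n) = L2_inner G u (eigfun G n)" for n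
  proof -
    have "eigval G n powr \<alpha> * L2_inner G ?v (eigfun G n) = eigval G n powr \<alpha> * L2_inner G u (eigfun G n)"
      using u v unfolding frac_laplacian_one_iff by metis
    then show ?thesis using eigval_pos[of n] by simp
  qed
  then show ?thesis
    unfolding torsional_rigidity_def graph_integral_eq_inner
    using parseval[OF L2(1) L2_const, of 1] parseval[OF L2(2) L2_const, of 1] by (simp add: sums_unique2)
qed

text \<open>For an eigenfunction \<open>\<psi>\<close> that does not belong to the chosen basis, only the eigenfunctions
  \<open>eigfun G n\<close> with the same eigenvalue contribute to \<open>\<psi>\<close>.\<close>

lemma torsion_pairing:
  assumes u: "frac_laplacian G \<alpha> u one" and \<psi>: "neg_laplacian G \<psi> (\<lambda>e x. \<mu> * \<psi> e x)"
  shows "\<mu> powr \<alpha> * L2_inner G u \<psi> = L2_inner G one \<psi>"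
proof -
  have uL2: "u \<in> L2 G" using u by (simp add: frac_laplacian_one_iff)
  have \<psi>L2: "\<psi> \<in> L2 G" by (rule neg_laplacian_mem_L2[OF \<psi>])
  have scale: "(\<lambda>e x. c * f e x) = c *\<^sub>R f" for c and f :: "'e graph_fun" by (simp add: fun_eq_iff)
  have orth: "\<mu> = eigval G n \<or> L2_inner G (eigfun G n) \<psi> = 0" for n
  proof -
    have "L2_inner G (\<mu> *\<^sub>R \<psi>) (eigfun G n) = L2_inner G (eigval G n *\<^sub>R eigfun G n) \<psi>"
      using neg_laplacian_green(1)[OF \<psi> _ eigfun_laplacian _ len_nonneg] \<psi>L2
      by (simp add: scale)
    then have "\<mu> * L2_inner G (eigfun G n) \<psi> = eigval G n * L2_inner G (eigfun G n) \<psi>"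
      using \<psi>L2 commute[OF \<psi>L2 eigfun_L2, of n] by (simp add: scale_left)
    then show ?thesis by auto
  qed
  \<comment> \<open>Either the pairing with \<psi> vanishes and both sides are 0, or \<mu> is the
    eigenvalue of index \<open>n\<close> and the coefficient equation of \<open>u\<close>
    applies.\<close>
  have eq: "\<mu> powr \<alpha> * (L2_inner G u (eigfun G n) * L2_inner G (eigfun G n) \<psi>)
      = L2_inner G one (eigfun G n) * L2_inner G (eigfun G n) \<psi>" for n
    using orth[of n] u unfolding frac_laplacian_one_iff by (auto simp: mult.assoc[symmetric])
  have "(\<lambda>n. L2_inner G one (eigfun G n) * L2_inner G (eigfun G n) \<psi>) sums (\<mu> powr \<alpha> * L2_inner G u \<psi>)"
    using sums_mult[OF parseval[OF uL2 \<psi>L2], of "\<mu> powr \<alpha>"] by (simp only: eq)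
  then show ?thesis using parseval[OF L2_const \<psi>L2, of 1] by (rule sums_unique2)
qed

end

section \<open>Passing between a graph and its doubled graph\<close>

definition lift :: "'e graph_fun \<Rightarrow> ('e \<times> bool) graph_fun" where
  "lift u = (\<lambda>(e, b). u e)"

text \<open>The adjoint of \<open>lift\<close>; taking the sum rather than the mean keeps the
  adjoint relation free of a factor.\<close>

definition fold_edges :: "('e \<times> bool) graph_fun \<Rightarrow> 'e graph_fun" where
  "fold_edges \<phi> e x = \<phi> (e, True) x + \<phi> (e, False) x"

lemma double_edges_simps [simp]:
  "tail (double_edges G) (e, b) = tail G e" "head (double_edges G) (e, b) = head G e"
  "len (double_edges G) (e, b) = len G e" "dirichlet (double_edges G) = dirichlet G"
  by (simp_all add: double_edges_def)

lemma sum_Times_bool: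
  fixes f :: "'e::finite \<times> bool \<Rightarrow> real"
  shows "(\<Sum>p | P (fst p). f p) = (\<Sum>e | P e. f (e, True) + f (e, False))"
proof -
  have "{p :: 'e \<times> bool. P (fst p)} = {e. P e} \<times> UNIV" by auto
  then have "(\<Sum>p | P (fst p). f p) = (\<Sum>(e, b)\<in>{e. P e} \<times> UNIV. f (e, b))"
    by (simp add: split_beta)
  also have "\<dots> = (\<Sum>e | P e. \<Sum>b\<in>UNIV. f (e, b))"
    by (rule sum.cartesian_product[symmetric])
  finally show ?thesis by (simp add: UNIV_bool add.commute)
qed

lemma sum_UNIV_Times_bool:
  fixes f :: "'e::finite \<times> bool \<Rightarrow> real"
  shows "sum f UNIV = (\<Sum>e\<in>UNIV. f (e, True) + f (e, False))"
  using sum_Times_bool[where P = "\<lambda>_. True" and f = f] by simp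

lemma lift_L2: "u \<in> L2 G \<Longrightarrow> lift u \<in> L2 (double_edges G)"
  by (simp add: L2_iff lift_def split_paired_all)

lemma L2_inner_lift:
  fixes G :: "('v, 'e::finite) metric_graph"
  assumes "u \<in> L2 G" "\<phi> \<in> L2 (double_edges G)"
  shows "L2_inner (double_edges G) (lift u) \<phi> = L2_inner G u (fold_edges \<phi>)"
proof -
  have \<phi>: "\<phi> (e, b) \<in> {f. square_integrable (edge_measure G e) f}" for e b
    using assms(2) unfolding L2_iff by (auto dest: spec[of _ "(e, b)"])
  have "(\<integral>x. u e x * fold_edges \<phi> e x \<partial>edge_measure G e)
      = (\<integral>x. u e x * \<phi> (e, True) x \<partial>edge_measure G e) + (\<integral>x. u e x * \<phi> (e, False) x \<partial>edge_measure G e)" for e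
    unfolding fold_edges_def distrib_left using assms(1) \<phi>
    by (intro Bochner_Integration.integral_add square_integrable_mult) (auto simp: L2_iff)
  then show ?thesis
    by (simp add: L2_inner_eq lift_def sum_UNIV_Times_bool)
qed

text \<open>Parallel copies share their end vertices, so the folded function takes twice the vertex
  values \<open>h\<close>, including the zeros at Dirichlet vertices. The edge ends at a vertex come
  in pairs, so the Kirchhoff sum of the folded derivative is the one in the doubled graph.\<close>

lemma fold_edges_laplacian:
  fixes G :: "('v, 'e::finite) metric_graph"
  assumes "neg_laplacian (double_edges G) \<phi> f"
  shows "neg_laplacian G (fold_edges \<phi>) (fold_edges f)"
proof -
  obtain \<phi>' \<phi>'' where \<phi>: "\<And>p. H2_derivs (len (double_edges G) p) (\<phi> p) (\<phi>' p) (\<phi>'' p)"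
    "continuous_at_vertices (double_edges G) \<phi>" "kirchhoff (double_edges G) \<phi>'"
    "\<And>p. AE x in edge_measure (double_edges G) p. f p x = - \<phi>'' p x"
    using assms unfolding neg_laplacian_def by blast
  show ?thesis
    unfolding neg_laplacian_def
  proof (intro exI conjI allI)
    show "H2_derivs (len G e) (fold_edges \<phi> e) (fold_edges \<phi>' e) (fold_edges \<phi>'' e)" for e
      using H2_derivs_add[of "len G e"] \<phi>(1)[of "(e, True)"] \<phi>(1)[of "(e, False)"]
      by (simp add: fold_edges_def[abs_def])
    obtain h where h: "\<And>p. \<phi> p 0 = h (tail (double_edges G) p)"
      "\<And>p. \<phi> p (len (double_edges G) p) = h (head (double_edges G) p)" "\<And>v. v \<in> dirichlet G \<Longrightarrow> h v = 0"
      using \<phi>(2) unfolding continuous_at_vertices_def by auto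
    have "\<phi> (e, b) (len G e) = h (head G e)" for e b using h(2)[of "(e, b)"] by simp
    then show "continuous_at_vertices G (fold_edges \<phi>)"
      unfolding continuous_at_vertices_def using h
      by (intro exI[of _ "\<lambda>v. 2 * h v"]) (simp add: fold_edges_def)
    show "kirchhoff G (fold_edges \<phi>')"
      unfolding kirchhoff_def
    proof (intro allI impI)
      fix v assume "v \<notin> dirichlet G"
      then have "(\<Sum>p | head (double_edges G) p = v. \<phi>' p (len (double_edges G) p))
          + (\<Sum>p | tail (double_edges G) p = v. - \<phi>' p 0) = 0"
        using \<phi>(3) unfolding kirchhoff_def by simp
      then show "(\<Sum>e | head G e = v. fold_edges \<phi>' e (len G e)) + (\<Sum>e | tail G e = v. - fold_edges \<phi>' e 0) = 0"
        using sum_Times_bool[where P = "\<lambda>e. head G e = v" and f = "\<lambda>p. \<phi>' p (len G (fst p))"]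
          sum_Times_bool[where P = "\<lambda>e. tail G e = v" and f = "\<lambda>p. - \<phi>' p 0"]
        by (simp add: fold_edges_def double_edges_def split_beta)
    qed
    show "AE x in edge_measure G e. fold_edges f e x = - fold_edges \<phi>'' e x" for e
      using \<phi>(4)[of "(e, True)", unfolded double_edges_simps] \<phi>(4)[of "(e, False)", unfolded double_edges_simps]
      by eventually_elim (simp add: fold_edges_def)
  qed
qed

lemma dirichlet_graph_double_edges:
  assumes "dirichlet_graph G"
  shows "dirichlet_graph (double_edges G)"
proof -
  interpret dirichlet_graph G by (rule assms)
  show ?thesis
  proof
    show "0 < len (double_edges G) p" for p
      using len_pos by (cases p) simp
    have "range (\<lambda>p. (tail (double_edges G) p, head (double_edges G) p)) = range (\<lambda>e. (tail G e, head G e))"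
      "range (\<lambda>p. (head (double_edges G) p, tail (double_edges G) p)) = range (\<lambda>e. (head G e, tail G e))"
      by (auto simp: double_edges_def split_beta image_iff)
    then show "graph_connected (double_edges G)"
      using connected by (simp add: graph_connected_def)
    show "dirichlet (double_edges G) \<noteq> {}" using dirichlet_nonempty by simp
  qed
qed

lemma frac_laplacian_lift:
  assumes "dirichlet_graph G" and u: "frac_laplacian G \<alpha> u (\<lambda>e x. 1)"
  shows "frac_laplacian (double_edges G) \<alpha> (lift u) (\<lambda>e x. 1)"
proof -
  interpret G: dirichlet_graph G by (rule assms(1))
  interpret D: dirichlet_graph "double_edges G" by (rule dirichlet_graph_double_edges[OF assms(1)])
  have uL2: "u \<in> L2 G" using u by (simp add: G.frac_laplacian_one_iff)
  have lift_one: "lift (\<lambda>e x. 1) = (\<lambda>e x. 1)" by (simp add: lift_def fun_eq_iff)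
  have "eigval (double_edges G) n powr \<alpha> * L2_inner (double_edges G) (lift u) (eigfun (double_edges G) n)
      = L2_inner (double_edges G) (\<lambda>e x. 1) (eigfun (double_edges G) n)" for n
  proof -
    let ?\<phi> = "eigfun (double_edges G) n" and ?\<mu> = "eigval (double_edges G) n"
    have "fold_edges (\<lambda>e x. ?\<mu> * ?\<phi> e x) = (\<lambda>e x. ?\<mu> * fold_edges ?\<phi> e x)"
      by (simp add: fold_edges_def fun_eq_iff distrib_left)
    then have "neg_laplacian G (fold_edges ?\<phi>) (\<lambda>e x. ?\<mu> * fold_edges ?\<phi> e x)"
      using fold_edges_laplacian[OF D.eigfun_laplacian[of n]] by simp
    then have "?\<mu> powr \<alpha> * L2_inner G u (fold_edges ?\<phi>) = L2_inner G (\<lambda>e x. 1) (fold_edges ?\<phi>)"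
      by (rule G.torsion_pairing[OF u])
    then show ?thesis
      using L2_inner_lift[OF uL2 D.eigfun_L2, of n] L2_inner_lift[OF L2_const D.eigfun_L2, of 1 n]
      by (simp add: lift_one)
  qed
  then show ?thesis using lift_L2[OF uL2] by (simp add: D.frac_laplacian_one_iff)
qed

theorem theorem6p1:
  fixes G :: "('v::finite, 'e::finite) metric_graph" and \<alpha> :: real
  assumes "0 < \<alpha>" and "\<alpha> < 1"
    and "\<forall>e. 0 < len G e"
    and "graph_connected G"
    and "dirichlet G \<noteq> {}"
  shows "torsional_rigidity G \<alpha> \<le> 1 / 2 * torsional_rigidity (double_edges G) \<alpha>"
proof -
  interpret G: dirichlet_graph G using assms by unfold_locales auto
  have dg: "dirichlet_graph G" by unfold_locales
  interpret D: dirichlet_graph "double_edges G" by (rule dirichlet_graph_double_edges[OF dg])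
  obtain u where u: "frac_laplacian G \<alpha> u (\<lambda>e x. 1)"
    using G.exists_torsion[OF assms(1)] by blast
  have "graph_integral (double_edges G) (lift u) = 2 * graph_integral G u"
    by (simp add: graph_integral_def lift_def sum_distrib_left sum_UNIV_Times_bool)
  then have "torsional_rigidity (double_edges G) \<alpha> = 2 * torsional_rigidity G \<alpha>"
    using G.torsional_rigidity_eq[OF u] D.torsional_rigidity_eq[OF frac_laplacian_lift[OF dg u]] by simp
  then show ?thesis by simp
qed

end
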